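(* Let $C,D\subset\mathbb{N}$ be two infinite subsets of integers and let $\mathcal{F}_C$ and $\mathcal{F}_D$ be the corresponding bases of dyadic rectangles. Then there exists a function $f\in L^1([0,1)^2)$ with $f\ge 0$ such that for almost every $z\in[0,1)^2$ we have $$\delta_{\mathcal{F}_C}(z,f)=0\qquad\text{and}\qquad\delta_{\mathcal{F}_D}(z,f)=\infty$$ if and only if $$\sup_{n\in D}\operatorname{dist}(n,C)=\infty.$$
   Context: For an infinite set $C\subset\mathbb{N}$, $$\mathcal{F}_C=\left\{\left[\tfrac{i-1}{2^n},\tfrac{i}{2^n}\right)\times\left[\tfrac{j-1}{2^m},\tfrac{j}{2^m}\right)\colon n,m\in C,\ 1\le i\le 2^n,\ 1\le j\le 2^m\right\},$$ and $\mathcal{F}_D$ is defined in the same way from $D$. For such a family $\mathcal{F}$ of rectangles, $f\in L^1$ and a point $z$, $$\delta_{\mathcal{F}}(z,f)=\limsup_{\substack{\operatorname{diam}R\to 0;\\ z\in R\in\mathcal{F}}}\left|\frac{1}{|R|}\int_R f\,dx\,dy-f(z)\right|,$$ where $|\cdot|$ is Lebesgue measure and $\operatorname{diam}R$ is the length of the diagonal of $R$. Also $\operatorname{dist}(n,C)=\min_{m\in C}|n-m|$. *)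

theory Defs
  imports "HOL-Analysis.Analysis"
begin

definition unit_square :: "(real \<times> real) set" where
  "unit_square = {0..<1} \<times> {0..<1}"

definition dyadic_interval :: "nat \<Rightarrow> nat \<Rightarrow> real set" where
  "dyadic_interval n i = {(real i - 1) / 2 ^ n ..< real i / 2 ^ n}"

definition dyadic_basis :: "nat set \<Rightarrow> (real \<times> real) set set" where
  "dyadic_basis C =
     {dyadic_interval n i \<times> dyadic_interval m j | n m i j.
        n \<in> C \<and> m \<in> C \<and> i \<in> {1..2 ^ n} \<and> j \<in> {1..2 ^ m}}"

(* The filter describing the limit "diam R \<rightarrow> 0 along R with z \<in> R \<in> \<F>". *)
definition shrinking_to ::
  "(real \<times> real) set set \<Rightarrow> real \<times> real \<Rightarrow> (real \<times> real) set filter" where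
  "shrinking_to \<F> z = inf (filtercomap diameter (nhds 0)) (principal {R \<in> \<F>. z \<in> R})"

(* The upper limit is extended-real valued, since it may be infinite.
   Limsup along the trivial filter is -\<infinity>; for an infinite set C and z in the unit square,
   the filter shrinking_to (dyadic_basis C) z is not trivial. *)
definition oscillation ::
  "(real \<times> real) set set \<Rightarrow> real \<times> real \<Rightarrow> (real \<times> real \<Rightarrow> real) \<Rightarrow> ereal" where
  "oscillation \<F> z f =
     Limsup (shrinking_to \<F> z)
       (\<lambda>R. ereal \<bar>(LINT w:R|lebesgue. f w) / measure lebesgue R - f z\<bar>)"

(* On nat, Inf is the least element of a nonempty set, so for nonempty C this infimum is the
   minimum; the value 0 for empty C is a convention. *)
definition dist_to_set :: "nat \<Rightarrow> nat set \<Rightarrow> nat" where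
  "dist_to_set n C = (INF m\<in>C. nat \<bar>int n - int m\<bar>)"

end

theory Submission
  imports Defs
begin

text \<open>
  If the distance to C is bounded by K on D, almost everywhere convergence along C leaves no room for almost
  everywhere divergence along D. Call a C-rectangle bad if its average exceeds M. Convergence along C
  makes the union of the fine bad rectangles small when M is large. A D-rectangle whose average exceeds
  4^K M must meet a bad C-rectangle of nearly the same shape (\<open>dyadic_average_le_of_nearby\<close>), and
  such D-rectangles cover at most 4^K times the measure of the bad ones
  (\<open>dyadic_rect_covering\<close>, a weak type estimate for the strong maximal operator: the
  one-dimensional covering lemma used once in each coordinate). So a set of positive measure meets no
  fine D-rectangle with a large average, and the D-oscillation is finite there
  (\<open>oscillation_finite_somewhere\<close>).

  If the distance to C is unbounded on D, there are levels d_0 < d_1 < ... in D such that C avoids a long window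
  around each of them. For digits, the window around d_t consists of u positions up to d_t and
  v positions after it; let A_t and B_t be the events that these digits of a number vanish, of
  probability a = 2^-u and b = 2^-v, and let X_t be their conjunction. At a level of C one sees
  either all of X_t or nothing of it, whereas at the level d_t one sees A_t but not yet B_t.

  Take N = M + 2 consecutive windows and let the spike be the event that both coordinates satisfy X_t
  in all of them. In the manner of Bohr's example for the strong maximal operator, consider the
  rectangles of level d_k in x and level d_(M-k) in y on which the first k (resp. M - k) windows are
  X and the next one is A. There are M + 1 choices of k, each covers a set of measure
  a^2 (ab)^M, these sets are disjoint up to a factor 1 - b, and the spike has the same
  density in each of them. Hence a multiple of the spike function with average h on all these rectangles
  has integral of order h^2/(M + 1) once independent copies, placed on later and later windows, are
  added until all but exp(-h) of the square is covered (\<open>prob2_no_good\<close>). Rectangles of C never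
  stop inside a window, so to see a comparable density they must have passed M + 1 full windows,
  which happens on a set smaller by the factor b/a (\<open>prob2_bad_le\<close>); off that set their
  averages are at most the integral plus h a^2 (\<open>dyadic_average_spikes_le\<close>).

  Choosing a small, b much smaller and M large gives functions g_k with integral at most 2^-k, with
  C-averages at most 2^-k off a set of measure 2^-k, and with D-averages at least k off another
  set of measure 2^-k (\<open>stage_function_exists\<close>). By Borel and Cantelli the sum of the g_k has
  the required behaviour almost everywhere (\<open>exists_divergent_function\<close>).
\<close>

section \<open>Dyadic intervals and rectangles\<close>

lemma mem_dyadic_interval_iff:
  "x \<in> dyadic_interval n i \<longleftrightarrow> \<lfloor>2 ^ n * x\<rfloor> = int i - 1"
  unfolding dyadic_interval_def floor_eq_iff by (auto simp: field_simps)

lemma dyadic_interval_cover: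
  assumes "x \<in> {0..<1}"
  obtains i where "i \<in> {1..2 ^ n}" "x \<in> dyadic_interval n i"
proof
  have "0 \<le> \<lfloor>2 ^ n * x\<rfloor>" "\<lfloor>2 ^ n * x\<rfloor> < 2 ^ n"
    using assms by (auto simp: floor_less_iff)
  then show "nat (\<lfloor>2 ^ n * x\<rfloor> + 1) \<in> {1..2 ^ n}"
    by (simp add: nat_le_iff Suc_le_eq)
  show "x \<in> dyadic_interval n (nat (\<lfloor>2 ^ n * x\<rfloor> + 1))"
    using \<open>0 \<le> \<lfloor>2 ^ n * x\<rfloor>\<close> by (simp add: mem_dyadic_interval_iff)
qed

lemma dyadic_interval_subset_unit:
  assumes "i \<in> {1..2 ^ n}"
  shows "dyadic_interval n i \<subseteq> {0..<1}"
proof -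
  have "real i \<le> 2 ^ n" "real i \<ge> 1"
    using assms by (auto simp flip: of_nat_le_iff)
  then have "0 \<le> (real i - 1) / 2 ^ n" "real i / 2 ^ n \<le> 1"
    by (auto simp: field_simps)
  then show ?thesis
    by (auto simp: dyadic_interval_def)
qed

lemma dyadic_interval_eq_translate:
  "dyadic_interval n i = (+) ((real i - 1) / 2 ^ n) ` dyadic_interval n 1"
proof -
  have "(real i - 1) / 2 ^ n + real 1 / 2 ^ n = real i / 2 ^ n"
    by (simp add: diff_divide_distrib)
  then show ?thesis
    by (simp add: dyadic_interval_def add.commute)
qed

lemma of_int_two_power_diff:
  "n \<le> q \<Longrightarrow> real_of_int (2 ^ (q - n)) = 2 ^ q / 2 ^ n"
  by (simp only: of_int_power of_int_numeral) (simp add: power_diff)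

lemma floor_finer:
  fixes x :: real
  assumes "n \<le> q"
  shows "\<lfloor>2 ^ n * x\<rfloor> = \<lfloor>2 ^ q * x\<rfloor> div 2 ^ (q - n)"
proof -
  have "2 ^ n * x = 2 ^ q * x / real_of_int (2 ^ (q - n))"
    by (simp only: of_int_two_power_diff[OF assms]) simp
  then show ?thesis
    by (simp only: floor_divide_real_eq_div zero_le_power zero_le_numeral)
qed

lemma dyadic_interval_nested:
  assumes "x \<in> dyadic_interval n i" "x \<in> dyadic_interval q j" "n \<le> q"
  shows "dyadic_interval q j \<subseteq> dyadic_interval n i"
  using assms by (auto simp: mem_dyadic_interval_iff floor_finer[OF assms(3)])

lemma dyadic_interval_borel [measurable, simp]: "dyadic_interval n i \<in> sets borel"
  by (simp add: dyadic_interval_def)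

lemma emeasure_dyadic_interval: "emeasure lborel (dyadic_interval n i) = ennreal (1 / 2 ^ n)"
proof -
  have "(real i - 1) / 2 ^ n \<le> real i / 2 ^ n"
    by (intro divide_right_mono) auto
  then show ?thesis
    by (simp add: dyadic_interval_def diff_divide_distrib)
qed

lemma measure_dyadic_interval: "measure lborel (dyadic_interval n i) = 1 / 2 ^ n"
  by (simp add: measure_def emeasure_dyadic_interval)

definition dyadic_rect :: "nat \<Rightarrow> nat \<Rightarrow> nat \<Rightarrow> nat \<Rightarrow> (real \<times> real) set" where
  "dyadic_rect n m i j = dyadic_interval n i \<times> dyadic_interval m j"

lemma mem_dyadic_rect_iff:
  "z \<in> dyadic_rect n m i j \<longleftrightarrow> \<lfloor>2 ^ n * fst z\<rfloor> = int i - 1 \<and> \<lfloor>2 ^ m * snd z\<rfloor> = int j - 1"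
  by (cases z) (auto simp: dyadic_rect_def mem_dyadic_interval_iff)

lemma dyadic_basis_alt:
  "dyadic_basis C = {dyadic_rect n m i j |n m i j. n \<in> C \<and> m \<in> C \<and> i \<in> {1..2 ^ n} \<and> j \<in> {1..2 ^ m}}"
  by (simp add: dyadic_basis_def dyadic_rect_def)

lemma unit_square_dyadic_cover:
  assumes "z \<in> unit_square"
  obtains i j where "i \<in> {1..2 ^ n}" "j \<in> {1..2 ^ m}" "z \<in> dyadic_rect n m i j"
proof -
  have "fst z \<in> {0..<1}" "snd z \<in> {0..<1}"
    using assms by (auto simp: unit_square_def)
  then obtain i j where "i \<in> {1..2 ^ n}" "fst z \<in> dyadic_interval n i"
    "j \<in> {1..2 ^ m}" "snd z \<in> dyadic_interval m j"
    by (metis dyadic_interval_cover)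
  then show ?thesis
    using that[of i j] by (cases z) (auto simp: dyadic_rect_def)
qed

lemma dyadic_rect_subset_unit_square:
  "i \<in> {1..2 ^ n} \<Longrightarrow> j \<in> {1..2 ^ m} \<Longrightarrow> dyadic_rect n m i j \<subseteq> unit_square"
  unfolding dyadic_rect_def unit_square_def
  by (intro Sigma_mono dyadic_interval_subset_unit)

lemma Times_borel:
  fixes A B :: "real set"
  shows "A \<in> sets borel \<Longrightarrow> B \<in> sets borel \<Longrightarrow> A \<times> B \<in> sets borel"
  by (simp only: borel_prod[symmetric] pair_measureI)

lemma measure_Times_borel:
  fixes A B :: "real set"
  assumes "A \<in> sets borel" "B \<in> sets borel" "emeasure lborel A < \<infinity>" "emeasure lborel B < \<infinity>"
  shows "measure lebesgue (A \<times> B) = measure lebesgue A * measure lebesgue B"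
proof -
  have "emeasure (lborel \<Otimes>\<^sub>M lborel) (A \<times> B) = emeasure lborel A * emeasure lborel B"
    using assms by (intro lborel.emeasure_pair_measure_Times) auto
  then have "measure lborel (A \<times> B) = measure lborel A * measure lborel B"
    by (simp add: lborel_prod measure_def enn2real_mult)
  moreover have "A \<times> B \<in> sets borel"
    using assms by (simp add: Times_borel)
  ultimately show ?thesis
    using assms by (simp add: measure_completion)
qed

lemma dyadic_rect_borel [measurable, simp]: "dyadic_rect n m i j \<in> sets borel"
  by (simp add: dyadic_rect_def Times_borel)

lemma unit_square_borel [measurable, simp]: "unit_square \<in> sets borel"
  by (simp add: unit_square_def Times_borel)

lemma measure_unit_square: "measure lebesgue unit_square = 1"
  by (simp add: unit_square_def measure_Times_borel measure_completion)

lemma measure_dyadic_rect: "measure lebesgue (dyadic_rect n m i j) = 1 / 2 ^ (n + m)"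
  unfolding dyadic_rect_def
  by (subst measure_Times_borel)
     (simp_all add: measure_completion measure_dyadic_interval power_add emeasure_dyadic_interval)

lemma bounded_unit_square: "bounded unit_square"
  unfolding unit_square_def by (intro bounded_Times bounded_subset[OF bounded_cbox[of 0 "1::real"]]) auto

lemma bounded_dyadic_rect: "bounded (dyadic_rect n m i j)"
  unfolding dyadic_rect_def dyadic_interval_def
  by (intro bounded_Times) (auto intro: bounded_subset[OF bounded_closed_interval])

lemma unit_square_lmeasurable: "unit_square \<in> lmeasurable"
  by (intro bounded_set_imp_lmeasurable bounded_unit_square lborelD) simp

lemma dyadic_rect_lmeasurable: "dyadic_rect n m i j \<in> lmeasurable"
  by (intro bounded_set_imp_lmeasurable bounded_dyadic_rect lborelD) simp

section \<open>The shrinking filter in terms of dyadic levels\<close>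

lemma diameter_dyadic_rect_le:
  "diameter (dyadic_rect n m i j) \<le> 1 / 2 ^ n + 1 / 2 ^ m"
proof (rule diameter_le)
  fix z w assume "z \<in> dyadic_rect n m i j" "w \<in> dyadic_rect n m i j"
  then have "\<bar>fst z - fst w\<bar> \<le> 1 / 2 ^ n" "\<bar>snd z - snd w\<bar> \<le> 1 / 2 ^ m"
    by (auto simp: dyadic_rect_def dyadic_interval_def diff_divide_distrib abs_le_iff)
  then show "norm (z - w) \<le> 1 / 2 ^ n + 1 / 2 ^ m"
    using norm_Pair_le[of "fst z - fst w" "snd z - snd w"] by (simp add: minus_prod_def)
qed simp

lemma diameter_dyadic_rect_ge:
  "diameter (dyadic_rect n m i j) \<ge> 1 / 2 ^ (n + 1)" "diameter (dyadic_rect n m i j) \<ge> 1 / 2 ^ (m + 1)"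
proof -
  let ?x = "(real i - 1) / 2 ^ n" and ?y = "(real j - 1) / 2 ^ m"
  have x: "?x \<in> dyadic_interval n i" "?x + 1 / 2 ^ (n + 1) \<in> dyadic_interval n i"
    and y: "?y \<in> dyadic_interval m j" "?y + 1 / 2 ^ (m + 1) \<in> dyadic_interval m j"
    by (auto simp: dyadic_interval_def field_simps)
  have "dist (?x, ?y) (?x + 1 / 2 ^ (n + 1), ?y) \<le> diameter (dyadic_rect n m i j)"
    using x y by (intro diameter_bounded_bound bounded_dyadic_rect) (auto simp: dyadic_rect_def)
  then show "diameter (dyadic_rect n m i j) \<ge> 1 / 2 ^ (n + 1)"
    by (simp add: dist_Pair_Pair dist_norm)
  have "dist (?x, ?y) (?x, ?y + 1 / 2 ^ (m + 1)) \<le> diameter (dyadic_rect n m i j)"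
    using x y by (intro diameter_bounded_bound bounded_dyadic_rect) (auto simp: dyadic_rect_def)
  then show "diameter (dyadic_rect n m i j) \<ge> 1 / 2 ^ (m + 1)"
    by (simp add: dist_Pair_Pair dist_norm)
qed

text \<open>
  The diameter of a dyadic rectangle is comparable to its longer side, so small diameter amounts to both
  levels being large. All arguments about oscillations below are phrased in this form.
\<close>
lemma eventually_shrinking_to_iff:
  "eventually P (shrinking_to (dyadic_basis C) z) \<longleftrightarrow>
     (\<exists>L. \<forall>n\<in>C. \<forall>m\<in>C. \<forall>i\<in>{1..2 ^ n}. \<forall>j\<in>{1..2 ^ m}.
        L \<le> n \<longrightarrow> L \<le> m \<longrightarrow> z \<in> dyadic_rect n m i j \<longrightarrow> P (dyadic_rect n m i j))"
  (is "_ \<longleftrightarrow> ?R")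
proof -
  have *: "eventually P (shrinking_to (dyadic_basis C) z) \<longleftrightarrow>
      (\<exists>e>0. \<forall>R. \<bar>diameter R\<bar> < e \<longrightarrow> R \<in> dyadic_basis C \<and> z \<in> R \<longrightarrow> P R)" (is "_ \<longleftrightarrow> ?E")
  proof -
    have "eventually P (shrinking_to (dyadic_basis C) z) \<longleftrightarrow>
      (\<exists>Q. eventually Q (nhds 0) \<and> (\<forall>R. Q (diameter R) \<longrightarrow> R \<in> dyadic_basis C \<and> z \<in> R \<longrightarrow> P R))"
      by (simp add: shrinking_to_def eventually_inf_principal eventually_filtercomap)
    also have "\<dots> \<longleftrightarrow> ?E"
    proof (intro iffI; elim exE conjE)
      fix Q assume "eventually Q (nhds (0::real))"
        and Q: "\<forall>R. Q (diameter R) \<longrightarrow> R \<in> dyadic_basis C \<and> z \<in> R \<longrightarrow> P R"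
      then obtain e where "e > 0" "\<And>x. \<bar>x\<bar> < e \<Longrightarrow> Q x"
        by (auto simp: eventually_nhds_metric dist_real_def)
      with Q show ?E by blast
    next
      fix e :: real assume "e > 0"
        and e: "\<forall>R. \<bar>diameter R\<bar> < e \<longrightarrow> R \<in> dyadic_basis C \<and> z \<in> R \<longrightarrow> P R"
      then show "\<exists>Q. eventually Q (nhds 0) \<and> (\<forall>R. Q (diameter R) \<longrightarrow> R \<in> dyadic_basis C \<and> z \<in> R \<longrightarrow> P R)"
        by (intro exI[of _ "\<lambda>x. \<bar>x\<bar> < e"]) (auto simp: eventually_nhds_metric dist_real_def)
    qed
    finally show ?thesis .
  qed
  show ?thesis
    unfolding *
  proof (intro iffI; elim exE conjE)
    fix e :: real assume "e > 0"
      and e: "\<forall>R. \<bar>diameter R\<bar> < e \<longrightarrow> R \<in> dyadic_basis C \<and> z \<in> R \<longrightarrow> P R"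
    obtain L where L: "(1/2::real) ^ L < e / 2"
      using \<open>e > 0\<close> real_arch_pow_inv[of "e/2" "1/2"] by auto
    have "P (dyadic_rect n m i j)"
      if "n \<in> C" "m \<in> C" "i \<in> {1..2 ^ n}" "j \<in> {1..2 ^ m}" "L \<le> n" "L \<le> m" "z \<in> dyadic_rect n m i j"
      for n m i j
    proof -
      have "(1/2::real) ^ n \<le> (1/2) ^ L" "(1/2::real) ^ m \<le> (1/2) ^ L"
        using that by (auto intro!: power_decreasing)
      then have "diameter (dyadic_rect n m i j) < e"
        using diameter_dyadic_rect_le[of n m i j] L by (simp add: power_divide)
      moreover have "diameter (dyadic_rect n m i j) \<ge> 0"
        by (rule diameter_ge_0[OF bounded_dyadic_rect])
      ultimately show ?thesis
        using e[rule_format, of "dyadic_rect n m i j"] that by (fastforce simp: dyadic_basis_alt)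
    qed
    then show ?R by blast
  next
    fix L assume L: "\<forall>n\<in>C. \<forall>m\<in>C. \<forall>i\<in>{1..2 ^ n}. \<forall>j\<in>{1..2 ^ m}.
        L \<le> n \<longrightarrow> L \<le> m \<longrightarrow> z \<in> dyadic_rect n m i j \<longrightarrow> P (dyadic_rect n m i j)"
    show "\<exists>e>0. \<forall>R. \<bar>diameter R\<bar> < e \<longrightarrow> R \<in> dyadic_basis C \<and> z \<in> R \<longrightarrow> P R"
    proof (intro exI[of _ "1 / 2 ^ (L + 1)"] conjI allI impI)
      fix R assume d: "\<bar>diameter R\<bar> < 1 / 2 ^ (L + 1)" and R: "R \<in> dyadic_basis C \<and> z \<in> R"
      then obtain n m i j where *: "R = dyadic_rect n m i j" "n \<in> C" "m \<in> C" "i \<in> {1..2 ^ n}" "j \<in> {1..2 ^ m}"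
        by (auto simp: dyadic_basis_alt)
      have "1 / 2 ^ (n + 1) < (1 / 2 ^ (L + 1) :: real)" "1 / 2 ^ (m + 1) < (1 / 2 ^ (L + 1) :: real)"
        using diameter_dyadic_rect_ge[where n=n and m=m and i=i and j=j] d * by auto
      then have "L \<le> n" "L \<le> m"
        by (auto simp: field_simps)
      then show "P R"
        using L * R by blast
    qed auto
  qed
qed

lemma shrinking_to_nontrivial:
  assumes "infinite C" "z \<in> unit_square"
  shows "shrinking_to (dyadic_basis C) z \<noteq> bot"
proof -
  have "\<not> eventually (\<lambda>_. False) (shrinking_to (dyadic_basis C) z)"
  proof
    assume "eventually (\<lambda>_. False) (shrinking_to (dyadic_basis C) z)"
    then obtain L where L: "\<And>n i j. n \<in> C \<Longrightarrow> i \<in> {1..2 ^ n} \<Longrightarrow> j \<in> {1..2 ^ n} \<Longrightarrow> L \<le> n \<Longrightarrow> z \<notin> dyadic_rect n n i j"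
      unfolding eventually_shrinking_to_iff by blast
    obtain n where "n \<in> C" "L \<le> n"
      using assms(1) by (meson infinite_nat_iff_unbounded_le)
    then show False
      using L unit_square_dyadic_cover[OF assms(2), of n n] by metis
  qed
  then show ?thesis
    by (auto simp: trivial_limit_def)
qed

definition dyadic_average :: "(real \<times> real \<Rightarrow> real) \<Rightarrow> nat \<Rightarrow> nat \<Rightarrow> nat \<Rightarrow> nat \<Rightarrow> real" where
  "dyadic_average f n m i j =
     (LINT w:dyadic_rect n m i j|lebesgue. f w) / measure lebesgue (dyadic_rect n m i j)"

lemma oscillation_eq_0I:
  assumes "infinite C" "z \<in> unit_square"
    and "\<And>e. e > 0 \<Longrightarrow> \<exists>L. \<forall>n\<in>C. \<forall>m\<in>C. \<forall>i\<in>{1..2 ^ n}. \<forall>j\<in>{1..2 ^ m}.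
        L \<le> n \<longrightarrow> L \<le> m \<longrightarrow> z \<in> dyadic_rect n m i j \<longrightarrow> \<bar>dyadic_average f n m i j - f z\<bar> \<le> e"
  shows "oscillation (dyadic_basis C) z f = 0"
proof (rule antisym)
  show "oscillation (dyadic_basis C) z f \<le> 0"
  proof (rule ereal_le_epsilon2)
    show "oscillation (dyadic_basis C) z f \<le> 0 + ereal e" if "0 < e" for e
      unfolding oscillation_def
      using assms(3)[OF that]
      by (intro Limsup_bounded) (simp only: eventually_shrinking_to_iff dyadic_average_def ereal_less_eq add_0)
  qed
  show "0 \<le> oscillation (dyadic_basis C) z f"
    unfolding oscillation_def
    by (intro le_Limsup shrinking_to_nontrivial assms always_eventually) auto
qed

lemma oscillation_eq_infI:
  assumes "\<And>B L. \<exists>n\<in>D. \<exists>m\<in>D. \<exists>i\<in>{1..2 ^ n}. \<exists>j\<in>{1..2 ^ m}.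
        L \<le> n \<and> L \<le> m \<and> z \<in> dyadic_rect n m i j \<and> B \<le> dyadic_average f n m i j"
  shows "oscillation (dyadic_basis D) z f = \<infinity>"
proof (rule ccontr)
  assume "oscillation (dyadic_basis D) z f \<noteq> \<infinity>"
  then obtain B where "oscillation (dyadic_basis D) z f < ereal B"
    using less_PInf_Ex_of_nat by auto
  then have "eventually (\<lambda>R. ereal \<bar>(LINT w:R|lebesgue. f w) / measure lebesgue R - f z\<bar> < ereal B)
      (shrinking_to (dyadic_basis D) z)"
    unfolding oscillation_def by (rule Limsup_lessD)
  then obtain L where "\<forall>n\<in>D. \<forall>m\<in>D. \<forall>i\<in>{1..2 ^ n}. \<forall>j\<in>{1..2 ^ m}.
        L \<le> n \<longrightarrow> L \<le> m \<longrightarrow> z \<in> dyadic_rect n m i j \<longrightarrow> \<bar>dyadic_average f n m i j - f z\<bar> < B"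
    unfolding eventually_shrinking_to_iff by (auto simp: dyadic_average_def)
  then show False
    using assms[of L "B + f z"] by force
qed

lemma oscillation_ltD:
  assumes "oscillation (dyadic_basis C) z f < ereal B"
  shows "\<exists>L. \<forall>n\<in>C. \<forall>m\<in>C. \<forall>i\<in>{1..2 ^ n}. \<forall>j\<in>{1..2 ^ m}.
        L \<le> n \<longrightarrow> L \<le> m \<longrightarrow> z \<in> dyadic_rect n m i j \<longrightarrow> \<bar>dyadic_average f n m i j - f z\<bar> < B"
proof -
  have "eventually (\<lambda>R. ereal \<bar>(LINT w:R|lebesgue. f w) / measure lebesgue R - f z\<bar> < ereal B)
      (shrinking_to (dyadic_basis C) z)"
    using assms unfolding oscillation_def by (rule Limsup_lessD)
  then show ?thesis
    unfolding eventually_shrinking_to_iff by (auto simp: dyadic_average_def)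
qed

lemma oscillation_finiteI:
  assumes "\<forall>n\<in>D. \<forall>m\<in>D. \<forall>i\<in>{1..2 ^ n}. \<forall>j\<in>{1..2 ^ m}.
        L \<le> n \<longrightarrow> L \<le> m \<longrightarrow> z \<in> dyadic_rect n m i j \<longrightarrow> \<bar>dyadic_average f n m i j\<bar> \<le> B"
  shows "oscillation (dyadic_basis D) z f \<noteq> \<infinity>"
proof -
  have "oscillation (dyadic_basis D) z f \<le> ereal (B + \<bar>f z\<bar>)"
    unfolding oscillation_def
  proof (rule Limsup_bounded)
    show "\<forall>\<^sub>F R in shrinking_to (dyadic_basis D) z.
      ereal \<bar>(LINT w:R|lebesgue. f w) / measure lebesgue R - f z\<bar> \<le> ereal (B + \<bar>f z\<bar>)"
      unfolding eventually_shrinking_to_iff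
    proof (intro exI[of _ L] ballI impI)
      fix n m i j
      assume "n \<in> D" "m \<in> D" "i \<in> {1..2 ^ n}" "j \<in> {1..2 ^ m}" "L \<le> n" "L \<le> m" "z \<in> dyadic_rect n m i j"
      then have "\<bar>dyadic_average f n m i j\<bar> \<le> B"
        using assms by blast
      then show "ereal \<bar>(LINT w:dyadic_rect n m i j|lebesgue. f w) / measure lebesgue (dyadic_rect n m i j) - f z\<bar>
          \<le> ereal (B + \<bar>f z\<bar>)"
        unfolding dyadic_average_def[symmetric] by simp
    qed
  qed
  then show ?thesis by auto
qed

section \<open>Covering by dyadic intervals and rectangles\<close>

lemma dyadic_interval_Int_cases:
  assumes "dyadic_interval n i \<inter> dyadic_interval q j \<noteq> {}"
  shows "dyadic_interval n i \<inter> dyadic_interval q j =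
    (if n \<le> q then dyadic_interval q j else dyadic_interval n i)"
proof -
  obtain x where "x \<in> dyadic_interval n i" "x \<in> dyadic_interval q j"
    using assms by blast
  then show ?thesis
    using dyadic_interval_nested[of x n i q j] dyadic_interval_nested[of x q j n i] by auto
qed

text \<open>
  Two dyadic intervals that meet are nested, so their intersection has the larger of the two levels.
\<close>
lemma emeasure_dyadic_interval_Int_ge:
  assumes "dyadic_interval n i \<inter> dyadic_interval q j \<noteq> {}" "q \<le> n + K"
  shows "emeasure lborel (dyadic_interval n i)
    \<le> 2 ^ K * emeasure lborel (dyadic_interval n i \<inter> dyadic_interval q j)"
proof -
  have "1 / 2 ^ n \<le> (2 ^ K * (1 / 2 ^ max n q) :: real)"
  proof -
    have "max n q \<le> n + K" using assms(2) by simp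
    then have "(2::real) ^ max n q \<le> 2 ^ (n + K)" by (intro power_increasing) auto
    then show ?thesis by (simp add: power_add field_simps)
  qed
  then have "ennreal (1 / 2 ^ n) \<le> ennreal (2 ^ K * (1 / 2 ^ max n q))"
    by (rule ennreal_leI)
  also have "\<dots> = 2 ^ K * ennreal (1 / 2 ^ max n q)"
  proof -
    have "ennreal (2 ^ K) = 2 ^ K"
      using ennreal_power[of 2 K] by simp
    then show ?thesis by (subst ennreal_mult) auto
  qed
  also have "ennreal (1 / 2 ^ max n q) = emeasure lborel (dyadic_interval n i \<inter> dyadic_interval q j)"
    unfolding dyadic_interval_Int_cases[OF assms(1)] by (simp add: emeasure_dyadic_interval max_def)
  finally show ?thesis by (simp only: emeasure_dyadic_interval)
qed

text \<open>
  This is the weak type inequality of the dyadic maximal function in the form of a covering lemma. Since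
  dyadic intervals are nested or disjoint, the maximal members of the family are disjoint and cover the
  union; their large parts are then disjoint too, so measures add on both sides.
\<close>
lemma dyadic_covering:
  fixes J J' :: "'i \<Rightarrow> real set" and c :: ennreal
  assumes "countable I"
    and dyadic: "\<And>k. k \<in> I \<Longrightarrow> \<exists>n i. J k = dyadic_interval n i"
    and sub: "\<And>k. k \<in> I \<Longrightarrow> J' k \<subseteq> J k" "\<And>k. k \<in> I \<Longrightarrow> J' k \<in> sets borel"
    and large: "\<And>k. k \<in> I \<Longrightarrow> emeasure lborel (J k) \<le> c * emeasure lborel (J' k)"
  shows "emeasure lborel (\<Union>k\<in>I. J k) \<le> c * emeasure lborel (\<Union>k\<in>I. J' k)"
proof -
  define Top where "Top = {U \<in> J ` I. \<forall>V\<in>J ` I. U \<subseteq> V \<longrightarrow> V = U}"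
  define rep where "rep U = (SOME k. k \<in> I \<and> J k = U)" for U
  have rep: "rep U \<in> I" "J (rep U) = U" if "U \<in> Top" for U
    using that someI_ex[of "\<lambda>k. k \<in> I \<and> J k = U"] unfolding rep_def Top_def by blast+
  have "countable Top"
    by (rule countable_subset[of _ "J ` I"]) (auto simp: Top_def assms(1))
  have comparable: "U \<subseteq> V \<or> V \<subseteq> U" if UV: "U \<in> J ` I" "V \<in> J ` I" "U \<inter> V \<noteq> {}" for U V
  proof -
    obtain n i m j where "U = dyadic_interval n i" "V = dyadic_interval m j"
      using UV dyadic by blast
    then show ?thesis
      using dyadic_interval_Int_cases[of n i m j] UV(3) by (metis inf.cobounded1 inf.cobounded2)
  qed
  have Top_disjoint: "U \<inter> V = {}" if "U \<in> Top" "V \<in> Top" "U \<noteq> V" for U V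
    using comparable[of U V] that unfolding Top_def by blast
  have disjoint: "disjoint_family_on (\<lambda>U. J' (rep U)) Top" 
  proof (unfold disjoint_family_on_def, intro ballI impI)
    fix U V assume UV: "U \<in> Top" "V \<in> Top" "U \<noteq> V"
    have "U \<inter> V = {}"
      using UV by (rule Top_disjoint)
    moreover have "J' (rep U) \<subseteq> U" "J' (rep V) \<subseteq> V"
      using sub(1)[OF rep(1)] rep(2) UV by blast+
    ultimately show "J' (rep U) \<inter> J' (rep V) = {}" by blast
  qed
  \<comment> \<open>Among the family members that contain a given one, a member of least level is maximal.\<close>
  have above: "\<exists>U\<in>Top. J k \<subseteq> U" if k: "k \<in> I" for k
  proof -
    define P where "P n \<longleftrightarrow> (\<exists>l\<in>I. \<exists>i. J l = dyadic_interval n i \<and> J k \<subseteq> J l)" for n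
    have "\<exists>n. P n" using dyadic[OF k] k unfolding P_def by blast
    then have least: "P (LEAST n. P n)" by (rule LeastI_ex)
    then obtain l i where l: "l \<in> I" "J l = dyadic_interval (LEAST n. P n) i" "J k \<subseteq> J l"
      unfolding P_def by blast
    have ne: "dyadic_interval n i \<noteq> {}" for n i
      using emeasure_dyadic_interval[of n i] by force
    have "V = J l" if V: "V \<in> J ` I" "J l \<subseteq> V" for V
    proof -
      obtain r m j where r: "r \<in> I" "V = J r" "J r = dyadic_interval m j"
        using V(1) dyadic by blast
      then have "P m"
        using l V unfolding P_def by blast
      then have le: "(LEAST n. P n) \<le> m" by (rule Least_le)
      obtain x where "x \<in> J l" using ne l(2) by fastforce
      then have "J r \<subseteq> J l"
        using dyadic_interval_nested[of x "LEAST n. P n" i m j] le l(2) r V(2) by auto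
      then show ?thesis using V(2) r(2) by blast
    qed
    then have "J l \<in> Top" using l(1) by (auto simp: Top_def)
    then show ?thesis using l(3) by blast
  qed
  have "emeasure lborel (\<Union>k\<in>I. J k) \<le> emeasure lborel (\<Union>U\<in>Top. U)"
  proof (rule emeasure_mono)
    show "(\<Union>k\<in>I. J k) \<subseteq> (\<Union>U\<in>Top. U)" using above by blast
    have "U \<in> sets lborel" if "U \<in> Top" for U
      using that dyadic unfolding Top_def by fastforce
    then show "(\<Union>U\<in>Top. U) \<in> sets lborel"
      by (intro sets.countable_UN'[OF \<open>countable Top\<close>]) auto
  qed
  also have "\<dots> = (\<integral>\<^sup>+U. emeasure lborel U \<partial>count_space Top)"
  proof (rule emeasure_UN_countable[OF _ \<open>countable Top\<close>])
    show "U \<in> sets lborel" if "U \<in> Top" for U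
      using that dyadic unfolding Top_def by fastforce
    show "disjoint_family_on (\<lambda>U. U) Top"
      unfolding disjoint_family_on_def using Top_disjoint by blast
  qed
  also have "\<dots> \<le> (\<integral>\<^sup>+U. c * emeasure lborel (J' (rep U)) \<partial>count_space Top)"
    using large[OF rep(1)] rep(2) by (intro nn_integral_mono) simp
  also have "\<dots> = c * (\<integral>\<^sup>+U. emeasure lborel (J' (rep U)) \<partial>count_space Top)"
    by (rule nn_integral_cmult) simp
  also have "(\<integral>\<^sup>+U. emeasure lborel (J' (rep U)) \<partial>count_space Top) = emeasure lborel (\<Union>U\<in>Top. J' (rep U))"
    using sub(2) rep(1) by (intro emeasure_UN_countable[symmetric] disjoint \<open>countable Top\<close>) simp
  also have "emeasure lborel (\<Union>U\<in>Top. J' (rep U)) \<le> emeasure lborel (\<Union>k\<in>I. J' k)"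
    using rep(1) sub(2) assms(1) by (intro emeasure_mono sets.countable_UN') auto
  finally show ?thesis by (simp add: mult_left_mono)
qed

lemma UN_Times_borel:
  fixes S T :: "'i \<Rightarrow> real set"
  assumes "countable I" "\<And>k. k \<in> I \<Longrightarrow> S k \<in> sets borel" "\<And>k. k \<in> I \<Longrightarrow> T k \<in> sets borel"
  shows "(\<Union>k\<in>I. S k \<times> T k) \<in> sets borel"
  using assms by (intro sets.countable_UN' image_subsetI Times_borel)

text \<open>
  The one-dimensional lemma on every vertical slice, integrated over the first coordinate. The sets
  \<open>S k\<close> are arbitrary, so that the lemma can be applied after one coordinate has been enlarged.
\<close>
lemma dyadic_covering_snd:
  fixes S J J' :: "'i \<Rightarrow> real set" and c :: ennreal
  assumes "countable I"
    and dyadic: "\<And>k. k \<in> I \<Longrightarrow> \<exists>n i. J k = dyadic_interval n i"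
    and sub: "\<And>k. k \<in> I \<Longrightarrow> J' k \<subseteq> J k" "\<And>k. k \<in> I \<Longrightarrow> J' k \<in> sets borel"
    and large: "\<And>k. k \<in> I \<Longrightarrow> emeasure lborel (J k) \<le> c * emeasure lborel (J' k)"
    and S: "\<And>k. k \<in> I \<Longrightarrow> S k \<in> sets borel"
  shows "emeasure lborel (\<Union>k\<in>I. S k \<times> J k) \<le> c * emeasure lborel (\<Union>k\<in>I. S k \<times> J' k)"
proof -
  have J: "J k \<in> sets borel" if "k \<in> I" for k using dyadic[OF that] by auto
  have m: "(\<Union>k\<in>I. S k \<times> J k) \<in> sets (lborel \<Otimes>\<^sub>M lborel)" "(\<Union>k\<in>I. S k \<times> J' k) \<in> sets (lborel \<Otimes>\<^sub>M lborel)"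
    unfolding lborel_prod sets_lborel by (intro UN_Times_borel assms(1) S J sub(2); assumption)+
  have slice: "Pair x -` (\<Union>k\<in>I. S k \<times> T k) = (\<Union>k\<in>{k \<in> I. x \<in> S k}. T k)" for x and T :: "'i \<Rightarrow> real set"
    by auto
  have "emeasure (lborel \<Otimes>\<^sub>M lborel) (\<Union>k\<in>I. S k \<times> J k) =
      (\<integral>\<^sup>+x. emeasure lborel (\<Union>k\<in>{k \<in> I. x \<in> S k}. J k) \<partial>lborel)"
    by (simp only: lborel.emeasure_pair_measure_alt[OF m(1)] slice)
  also have "\<dots> \<le> (\<integral>\<^sup>+x. c * emeasure lborel (\<Union>k\<in>{k \<in> I. x \<in> S k}. J' k) \<partial>lborel)"
    using assms by (intro nn_integral_mono dyadic_covering) auto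
  also have "\<dots> = c * (\<integral>\<^sup>+x. emeasure lborel (\<Union>k\<in>{k \<in> I. x \<in> S k}. J' k) \<partial>lborel)"
    using lborel.measurable_emeasure_Pair[OF m(2)] by (intro nn_integral_cmult) (simp only: slice)
  also have "\<dots> = c * emeasure (lborel \<Otimes>\<^sub>M lborel) (\<Union>k\<in>I. S k \<times> J' k)"
    by (simp only: lborel.emeasure_pair_measure_alt[OF m(2)] slice)
  finally show ?thesis by (simp only: lborel_prod)
qed

lemma emeasure_lborel_swap:
  fixes X :: "(real \<times> real) set"
  assumes "X \<in> sets borel"
  shows "emeasure lborel (prod.swap ` X) = emeasure lborel X"
proof -
  have eq: "prod.swap ` X = (\<lambda>(x, y). (y, x)) -` X \<inter> space (lborel \<Otimes>\<^sub>M lborel)"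
    by (force simp: space_pair_measure)
  have X: "X \<in> sets (lborel \<Otimes>\<^sub>M lborel)"
    unfolding lborel_prod sets_lborel by (rule assms)
  have "emeasure (lborel \<Otimes>\<^sub>M lborel) X =
      emeasure (distr (lborel \<Otimes>\<^sub>M lborel) (lborel \<Otimes>\<^sub>M lborel) (\<lambda>(x, y). (y, x))) X"
    by (subst lborel_pair.distr_pair_swap) simp
  also have "\<dots> = emeasure (lborel \<Otimes>\<^sub>M lborel) (prod.swap ` X)"
    unfolding eq by (rule emeasure_distr[OF _ X]) measurable
  finally show ?thesis by (simp only: lborel_prod)
qed

text \<open>
  Enlarging first the second and then the first coordinate costs one factor \<open>c\<close> each. Rectangles of
  different shapes are not nested, and this iteration replaces the selection of maximal members.
\<close>
lemma dyadic_rect_covering: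
  fixes U U' V V' :: "'i \<Rightarrow> real set" and c :: ennreal
  assumes "countable I"
    and U: "\<And>k. k \<in> I \<Longrightarrow> \<exists>n i. U k = dyadic_interval n i"
      "\<And>k. k \<in> I \<Longrightarrow> U' k \<subseteq> U k" "\<And>k. k \<in> I \<Longrightarrow> U' k \<in> sets borel"
      "\<And>k. k \<in> I \<Longrightarrow> emeasure lborel (U k) \<le> c * emeasure lborel (U' k)"
    and V: "\<And>k. k \<in> I \<Longrightarrow> \<exists>n i. V k = dyadic_interval n i"
      "\<And>k. k \<in> I \<Longrightarrow> V' k \<subseteq> V k" "\<And>k. k \<in> I \<Longrightarrow> V' k \<in> sets borel"
      "\<And>k. k \<in> I \<Longrightarrow> emeasure lborel (V k) \<le> c * emeasure lborel (V' k)"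
  shows "emeasure lborel (\<Union>k\<in>I. U k \<times> V k) \<le> c * (c * emeasure lborel (\<Union>k\<in>I. U' k \<times> V' k))"
proof -
  have Ub: "U k \<in> sets borel" if "k \<in> I" for k using U(1)[OF that] by auto
  have swap: "prod.swap ` (\<Union>k\<in>I. W k \<times> V' k) = (\<Union>k\<in>I. V' k \<times> W k)" for W :: "'i \<Rightarrow> real set"
    by force
  have "emeasure lborel (\<Union>k\<in>I. U k \<times> V k) \<le> c * emeasure lborel (\<Union>k\<in>I. U k \<times> V' k)"
    by (rule dyadic_covering_snd[OF assms(1) V Ub])
  also have "emeasure lborel (\<Union>k\<in>I. U k \<times> V' k) = emeasure lborel (\<Union>k\<in>I. V' k \<times> U k)"
    by (simp only: emeasure_lborel_swap[OF UN_Times_borel[OF assms(1) Ub V(3)], symmetric] swap)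
  also have "emeasure lborel (\<Union>k\<in>I. V' k \<times> U k) \<le> c * emeasure lborel (\<Union>k\<in>I. V' k \<times> U' k)"
    by (rule dyadic_covering_snd[OF assms(1) U V(3)])
  also have "emeasure lborel (\<Union>k\<in>I. V' k \<times> U' k) = emeasure lborel (\<Union>k\<in>I. U' k \<times> V' k)"
    by (simp only: emeasure_lborel_swap[OF UN_Times_borel[OF assms(1) U(3) V(3)], symmetric] swap)
  finally show ?thesis by (simp add: mult_left_mono)
qed

section \<open>Levels of D at bounded distance from C\<close>

text \<open>
  Rectangles of level \<open>(n', m')\<close> that meet the given rectangle cover it, and each has measure at most
  \<open>4 ^ K\<close> times that of its intersection with it. The intersections are disjoint, so these rectangles
  together have at most \<open>4 ^ K\<close> times the measure of the given one.
\<close>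
lemma dyadic_average_le_of_nearby:
  fixes f :: "real \<times> real \<Rightarrow> real"
  assumes f: "set_integrable lebesgue unit_square f" "\<And>w. w \<in> unit_square \<Longrightarrow> 0 \<le> f w"
    and near: "n \<le> n' + K" "m \<le> m' + K" and ij: "i \<in> {1..2 ^ n}" "j \<in> {1..2 ^ m}"
    and le: "\<And>i' j'. i' \<in> {1..2 ^ n'} \<Longrightarrow> j' \<in> {1..2 ^ m'} \<Longrightarrow>
      dyadic_rect n m i j \<inter> dyadic_rect n' m' i' j' \<noteq> {} \<Longrightarrow> dyadic_average f n' m' i' j' \<le> B"
    and "0 \<le> B"
  shows "dyadic_average f n m i j \<le> 4 ^ K * B"
proof -
  let ?R = "dyadic_rect n m i j"
  let ?Q = "\<lambda>p. dyadic_rect n' m' (fst p) (snd p)"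
  let ?q = "1 / 2 ^ (n' + m') :: real"
  define F where "F = {p \<in> {1..2 ^ n'} \<times> {1..2 ^ m'}. ?R \<inter> ?Q p \<noteq> {}}"
  have fin: "finite F" unfolding F_def by (rule finite_subset[of _ "{1..2 ^ n'} \<times> {1..2 ^ m'}"]) auto
  have Q_sub: "?Q p \<subseteq> unit_square" if "p \<in> F" for p
    using that unfolding F_def by (intro dyadic_rect_subset_unit_square) auto
  have int: "set_integrable lebesgue (dyadic_rect k l a b) f" if "dyadic_rect k l a b \<subseteq> unit_square" for k l a b
    using f(1) by (rule set_integrable_subset) (auto intro!: lborelD that)
  have q0: "0 < ?q" by simp
  have "(LINT w:?R|lebesgue. f w) \<le> (LINT w|lebesgue. (\<Sum>p\<in>F. indicator (?Q p) w *\<^sub>R f w))"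
    unfolding set_lebesgue_integral_def
  proof (rule integral_mono)
    show "integrable lebesgue (\<lambda>w. indicator ?R w *\<^sub>R f w)"
      using int[OF dyadic_rect_subset_unit_square[OF ij]] unfolding set_integrable_def .
    show "integrable lebesgue (\<lambda>w. \<Sum>p\<in>F. indicator (?Q p) w *\<^sub>R f w)"
      using int[OF Q_sub] unfolding set_integrable_def by (intro Bochner_Integration.integrable_sum)
    fix w
    have nonneg: "0 \<le> indicator (?Q p) w *\<^sub>R f w" if "p \<in> F" for p
      using Q_sub[OF that] f(2)[of w] by (auto simp: indicator_def)
    show "indicator ?R w *\<^sub>R f w \<le> (\<Sum>p\<in>F. indicator (?Q p) w *\<^sub>R f w)"
    proof (cases "w \<in> ?R")
      case True
      then have "w \<in> unit_square" using dyadic_rect_subset_unit_square[OF ij] by blast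
      then obtain a b where ab: "a \<in> {1..2 ^ n'}" "b \<in> {1..2 ^ m'}" "w \<in> dyadic_rect n' m' a b"
        using unit_square_dyadic_cover[of w n' m'] by blast
      then have "(a, b) \<in> F" using True unfolding F_def by auto
      then have "indicator (?Q (a, b)) w *\<^sub>R f w \<le> (\<Sum>p\<in>F. indicator (?Q p) w *\<^sub>R f w)"
        using fin nonneg by (intro member_le_sum) auto
      then show ?thesis using True ab(3) by simp
    next
      case False
      then show ?thesis using nonneg by (simp add: sum_nonneg)
    qed
  qed
  also have "\<dots> = (\<Sum>p\<in>F. LINT w:?Q p|lebesgue. f w)"
    using int[OF Q_sub] unfolding set_integrable_def set_lebesgue_integral_def
    by (intro Bochner_Integration.integral_sum)
  also have "\<dots> \<le> (\<Sum>p\<in>F. B * ?q)"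
  proof (rule sum_mono)
    fix p assume p: "p \<in> F"
    then have "dyadic_average f n' m' (fst p) (snd p) \<le> B"
      unfolding F_def by (intro le) auto
    then show "(LINT w:?Q p|lebesgue. f w) \<le> B * ?q"
      using q0 unfolding dyadic_average_def measure_dyadic_rect by (simp only: pos_divide_le_eq)
  qed
  also have "\<dots> = B * (card F * ?q)" by simp
  also have "\<dots> \<le> B * (4 ^ K * measure lebesgue ?R)"
  proof (rule mult_left_mono[OF _ \<open>0 \<le> B\<close>])
    have inter: "?q \<le> 4 ^ K * measure lebesgue (?R \<inter> ?Q p)" if p: "p \<in> F" for p
    proof -
      let ?I = "dyadic_interval n i \<inter> dyadic_interval n' (fst p)"
      let ?J = "dyadic_interval m j \<inter> dyadic_interval m' (snd p)"
      have eq: "?R \<inter> ?Q p = ?I \<times> ?J" by (auto simp: dyadic_rect_def)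
      then have ne: "?I \<noteq> {}" "?J \<noteq> {}" using p by (auto simp: F_def)
      have I: "?I = dyadic_interval (max n n') (if n \<le> n' then fst p else i)"
        unfolding dyadic_interval_Int_cases[OF ne(1)] by (simp add: max_def)
      have J: "?J = dyadic_interval (max m m') (if m \<le> m' then snd p else j)"
        unfolding dyadic_interval_Int_cases[OF ne(2)] by (simp add: max_def)
      have "?R \<inter> ?Q p = dyadic_rect (max n n') (max m m') (if n \<le> n' then fst p else i) (if m \<le> m' then snd p else j)"
        unfolding eq I J by (simp add: dyadic_rect_def)
      then have m: "measure lebesgue (?R \<inter> ?Q p) = 1 / 2 ^ (max n n' + max m m')"
        by (simp only: measure_dyadic_rect)
      have "(2::real) ^ (max n n' + max m m') \<le> 2 ^ (n' + m' + 2 * K)"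
        using near by (intro power_increasing) auto
      then have "(2::real) ^ (max n n' + max m m') \<le> 2 ^ (n' + m') * 4 ^ K"
        by (simp only: power_add power_mult) simp
      then show ?thesis
        unfolding m by (simp add: divide_simps mult.commute del: max_def)
    qed
    have "card F * ?q = (\<Sum>p\<in>F. ?q)" by simp
    also have "\<dots> \<le> (\<Sum>p\<in>F. 4 ^ K * measure lebesgue (?R \<inter> ?Q p))"
      by (intro sum_mono inter)
    also have "\<dots> = 4 ^ K * (\<Sum>p\<in>F. measure lebesgue (?R \<inter> ?Q p))"
      by (simp only: sum_distrib_left)
    also have "(\<Sum>p\<in>F. measure lebesgue (?R \<inter> ?Q p)) = measure lebesgue (\<Union>p\<in>F. ?R \<inter> ?Q p)"
    proof (rule measure_UNION'[symmetric, OF fin])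
      show "?R \<inter> ?Q p \<in> lmeasurable" for p
        by (intro fmeasurable.Int dyadic_rect_lmeasurable)
      show "pairwise (\<lambda>p p'. disjnt (?R \<inter> ?Q p) (?R \<inter> ?Q p')) F"
        by (auto simp: pairwise_def disjnt_def mem_dyadic_rect_iff)
    qed
    also have "measure lebesgue (\<Union>p\<in>F. ?R \<inter> ?Q p) \<le> measure lebesgue ?R"
      using fin by (intro measure_mono_fmeasurable dyadic_rect_lmeasurable sets.finite_UN sets.Int lborelD) auto
    finally show "card F * ?q \<le> 4 ^ K * measure lebesgue ?R" by simp
  qed
  finally show ?thesis
    unfolding dyadic_average_def measure_dyadic_rect by (simp add: field_simps)
qed

lemma nearby_levels:
  assumes "C \<noteq> {}" "(SUP n\<in>D. enat (dist_to_set n C)) \<noteq> \<infinity>"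
  obtains K where "\<And>n. n \<in> D \<Longrightarrow> \<exists>c\<in>C. n \<le> c + K \<and> c \<le> n + K"
proof -
  obtain K where K: "(SUP n\<in>D. enat (dist_to_set n C)) = enat K"
    using assms(2) by (cases "SUP n\<in>D. enat (dist_to_set n C)") auto
  have "\<exists>c\<in>C. n \<le> c + K \<and> c \<le> n + K" if "n \<in> D" for n
  proof -
    have "enat (dist_to_set n C) \<le> enat K"
      unfolding K[symmetric] using that by (rule SUP_upper)
    moreover have "dist_to_set n C \<in> (\<lambda>c. nat \<bar>int n - int c\<bar>) ` C"
      unfolding dist_to_set_def using assms(1) by (intro Inf_nat_def1) simp
    ultimately obtain c where "c \<in> C" "nat \<bar>int n - int c\<bar> \<le> K" by auto
    then show ?thesis by (intro bexI[of _ c]) linarith+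
  qed
  then show ?thesis using that by blast
qed

text \<open>
  With \<open>A M\<close> the union of the \<open>C\<close>-rectangles of levels at least \<open>M\<close> and average above
  \<open>M\<close>, convergence along \<open>C\<close> makes the decreasing sets \<open>A M\<close> shrink to a null set. For
  large \<open>M\<close> the covering lemma keeps the rectangles near the bad ones from filling the square, and
  every other point sees bounded averages along \<open>D\<close>.
\<close>
lemma oscillation_finite_somewhere:
  fixes f :: "real \<times> real \<Rightarrow> real"
  assumes "infinite C" "(SUP n\<in>D. enat (dist_to_set n C)) \<noteq> \<infinity>"
    and f: "set_integrable lebesgue unit_square f" "\<And>w. w \<in> unit_square \<Longrightarrow> 0 \<le> f w"
    and converges: "AE z in lebesgue. z \<in> unit_square \<longrightarrow> oscillation (dyadic_basis C) z f = 0"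
  shows "\<not> (AE z in lebesgue. z \<in> unit_square \<longrightarrow> oscillation (dyadic_basis D) z f = \<infinity>)"
proof
  assume diverges: "AE z in lebesgue. z \<in> unit_square \<longrightarrow> oscillation (dyadic_basis D) z f = \<infinity>"
  have "C \<noteq> {}" using assms(1) by auto
  then obtain K where K: "\<And>n. n \<in> D \<Longrightarrow> \<exists>c\<in>C. n \<le> c + K \<and> c \<le> n + K"
    using nearby_levels[OF _ assms(2)] by blast

  define bad where "bad M = {(n, m, i, j). n \<in> C \<and> m \<in> C \<and> i \<in> {1..2 ^ n} \<and> j \<in> {1..2 ^ m} \<and>
      M \<le> n \<and> M \<le> m \<and> real M < dyadic_average f n m i j}" for M :: nat
  define A where "A M = (\<Union>(n, m, i, j)\<in>bad M. dyadic_rect n m i j)" for M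
  have A_borel: "A M \<in> sets borel" for M
    unfolding A_def by (intro sets.countable_UN' countableI_type) auto
  have A_sub: "A M \<subseteq> unit_square" for M
    unfolding A_def bad_def using dyadic_rect_subset_unit_square by fastforce
  have A_mono: "A N \<subseteq> A M" if "M \<le> N" for M N
    unfolding A_def bad_def using that by fastforce
  have fin: "emeasure lebesgue (A M) < \<infinity>" for M
  proof -
    have "A M \<in> lmeasurable"
      using A_borel by (intro bounded_set_imp_lmeasurable bounded_subset[OF bounded_unit_square A_sub]) simp
    then show ?thesis using A_borel by (simp add: fmeasurable_def)
  qed
  have "AE z in lebesgue. z \<notin> (\<Inter>M. A M)"
    using converges
  proof eventually_elim
    case (elim z)
    show ?case
    proof (cases "z \<in> unit_square")
      case True
      with elim have "oscillation (dyadic_basis C) z f < ereal 1" by simp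
      then obtain L where L: "\<forall>n\<in>C. \<forall>m\<in>C. \<forall>i\<in>{1..2 ^ n}. \<forall>j\<in>{1..2 ^ m}.
        L \<le> n \<longrightarrow> L \<le> m \<longrightarrow> z \<in> dyadic_rect n m i j \<longrightarrow> \<bar>dyadic_average f n m i j - f z\<bar> < 1"
        using oscillation_ltD by blast
      \<comment> \<open>Past this index the averages at \<open>z\<close> stay below \<open>f z + 1\<close>.\<close>
      define M where "M = max L (nat \<lceil>f z + 1\<rceil>)"
      have M: "L \<le> M" "f z + 1 \<le> M" unfolding M_def by linarith+
      have "z \<notin> A M"
      proof
        assume "z \<in> A M"
        then obtain n m i j where *: "n \<in> C" "m \<in> C" "i \<in> {1..2 ^ n}" "j \<in> {1..2 ^ m}" "M \<le> n" "M \<le> m"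
          "real M < dyadic_average f n m i j" "z \<in> dyadic_rect n m i j"
          unfolding A_def bad_def by blast
        then have "\<bar>dyadic_average f n m i j - f z\<bar> < 1"
          using L M(1) by (meson order_trans)
        then show False using *(7) M(2) by linarith
      qed
      then show ?thesis by blast
    next
      case False
      then show ?thesis using A_sub by blast
    qed
  qed
  moreover have "(\<Inter>M. A M) \<in> sets lebesgue"
    using A_borel by (intro sets.countable_INT'' sets_completionI_sets) auto
  ultimately have "emeasure lebesgue (\<Inter>M. A M) = 0"
    using AE_iff_null_sets null_setsD1 by blast
  moreover have "(\<lambda>M. emeasure lebesgue (A M)) \<longlonglongrightarrow> emeasure lebesgue (\<Inter>M. A M)"
  proof (rule Lim_emeasure_decseq)
    show "range A \<subseteq> sets lebesgue" using A_borel by (auto intro: sets_completionI_sets)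
    show "decseq A" unfolding decseq_def using A_mono by blast
    show "emeasure lebesgue (A M) \<noteq> \<infinity>" for M using fin[of M] by (metis less_irrefl)
  qed
  ultimately have "(\<lambda>M. emeasure lebesgue (A M)) \<longlonglongrightarrow> 0" by simp
  moreover have "(0::ennreal) < 1 / (2 ^ K * 2 ^ K)"
    by (simp add: ennreal_zero_less_divide ennreal_mult_less_top power_less_top_ennreal)
  ultimately have "\<forall>\<^sub>F M in sequentially. emeasure lebesgue (A M) < 1 / (2 ^ K * 2 ^ K)"
    by (rule order_tendstoD)
  have c: "0 < (2 ^ K * 2 ^ K :: ennreal)" "(2 ^ K * 2 ^ K :: ennreal) \<noteq> 0" "(2 ^ K * 2 ^ K :: ennreal) < top"
  proof -
    have "ennreal (2 ^ K * 2 ^ K) = 2 ^ K * 2 ^ K"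
      using ennreal_power[of 2 K] by (subst ennreal_mult) auto
    moreover have "0 < ennreal (2 ^ K * 2 ^ K)" "ennreal (2 ^ K * 2 ^ K) < top" by simp_all
    ultimately show "0 < (2 ^ K * 2 ^ K :: ennreal)" "(2 ^ K * 2 ^ K :: ennreal) \<noteq> 0" "(2 ^ K * 2 ^ K :: ennreal) < top"
      by simp_all
  qed
  from \<open>\<forall>\<^sub>F M in sequentially. emeasure lebesgue (A M) < 1 / (2 ^ K * 2 ^ K)\<close>
  obtain M where M: "emeasure lebesgue (A M) < 1 / (2 ^ K * 2 ^ K)"
    by (auto simp: eventually_sequentially)

  \<comment> \<open>The indices are pairs of a rectangle to be covered and a bad \<open>C\<close>-rectangle meeting it; the
    intersection of the two is the large part that lies in \<open>A M\<close>.\<close>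
  define I where "I = {((n, m, i, j), (n', m', i', j')). (n', m', i', j') \<in> bad M \<and>
      i \<in> {1..2 ^ n} \<and> j \<in> {1..2 ^ m} \<and> n' \<le> n + K \<and> m' \<le> m + K \<and>
      dyadic_rect n m i j \<inter> dyadic_rect n' m' i' j' \<noteq> {}}"
  define U where "U = (\<lambda>((n :: nat, m :: nat, i :: nat, j :: nat), (n' :: nat, m' :: nat, i' :: nat, j' :: nat)). dyadic_interval n i)"
  define V where "V = (\<lambda>((n :: nat, m :: nat, i :: nat, j :: nat), (n' :: nat, m' :: nat, i' :: nat, j' :: nat)). dyadic_interval m j)"
  define U' where "U' = (\<lambda>((n :: nat, m :: nat, i :: nat, j :: nat), (n' :: nat, m' :: nat, i' :: nat, j' :: nat)).
      dyadic_interval n i \<inter> dyadic_interval n' i')"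
  define V' where "V' = (\<lambda>((n :: nat, m :: nat, i :: nat, j :: nat), (n' :: nat, m' :: nat, i' :: nat, j' :: nat)).
      dyadic_interval m j \<inter> dyadic_interval m' j')"
  have cover: "emeasure lborel (\<Union>k\<in>I. U k \<times> V k) \<le> 2 ^ K * (2 ^ K * emeasure lborel (\<Union>k\<in>I. U' k \<times> V' k))"
  proof (rule dyadic_rect_covering)
    show "countable I" by (rule countableI_type)
    fix k assume "k \<in> I"
    then obtain n m i j n' m' i' j' where k: "k = ((n, m, i, j), (n', m', i', j'))"
      "n' \<le> n + K" "m' \<le> m + K" "dyadic_rect n m i j \<inter> dyadic_rect n' m' i' j' \<noteq> {}"
      unfolding I_def by blast
    then have ne: "dyadic_interval n i \<inter> dyadic_interval n' i' \<noteq> {}" "dyadic_interval m j \<inter> dyadic_interval m' j' \<noteq> {}"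
      by (auto simp: dyadic_rect_def)
    have eqs: "U k = dyadic_interval n i" "V k = dyadic_interval m j"
      "U' k = dyadic_interval n i \<inter> dyadic_interval n' i'" "V' k = dyadic_interval m j \<inter> dyadic_interval m' j'"
      by (simp_all add: U_def V_def U'_def V'_def k(1))
    show "\<exists>n i. U k = dyadic_interval n i" "\<exists>n i. V k = dyadic_interval n i"
      "U' k \<subseteq> U k" "V' k \<subseteq> V k" "U' k \<in> sets borel" "V' k \<in> sets borel"
      by (auto simp: eqs)
    show "emeasure lborel (U k) \<le> 2 ^ K * emeasure lborel (U' k)"
      unfolding eqs by (rule emeasure_dyadic_interval_Int_ge[OF ne(1) k(2)])
    show "emeasure lborel (V k) \<le> 2 ^ K * emeasure lborel (V' k)"
      unfolding eqs by (rule emeasure_dyadic_interval_Int_ge[OF ne(2) k(3)])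
  qed
  have "(\<Union>k\<in>I. U' k \<times> V' k) \<subseteq> A M"
  proof
    fix z assume "z \<in> (\<Union>k\<in>I. U' k \<times> V' k)"
    then obtain n m i j n' m' i' j' where "(n', m', i', j') \<in> bad M"
      "z \<in> U' ((n, m, i, j), (n', m', i', j')) \<times> V' ((n, m, i, j), (n', m', i', j'))"
      unfolding I_def by blast
    moreover from this(2) have "z \<in> dyadic_rect n' m' i' j'"
      by (auto simp: U'_def V'_def dyadic_rect_def)
    ultimately show "z \<in> A M" unfolding A_def by blast
  qed
  then have "emeasure lborel (\<Union>k\<in>I. U' k \<times> V' k) \<le> emeasure lborel (A M)"
    using A_borel by (intro emeasure_mono) auto
  also have "emeasure lborel (A M) = emeasure lebesgue (A M)"
    using A_borel[of M] by simp
  finally have "emeasure lborel (\<Union>k\<in>I. U k \<times> V k) \<le> 2 ^ K * (2 ^ K * emeasure lebesgue (A M))"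
    by (intro order_trans[OF cover] mult_left_mono) auto
  also have "\<dots> = (2 ^ K * 2 ^ K) * emeasure lebesgue (A M)"
    by (simp only: mult.assoc)
  also have "\<dots> < (2 ^ K * 2 ^ K) * (1 / (2 ^ K * 2 ^ K))"
    using M c by (intro ennreal_mult_strict_left_mono) auto
  also have "\<dots> = 1"
    by (simp only: ennreal_times_divide mult_1_right ennreal_divide_self[OF c(2,3)])
  finally have small: "emeasure lborel (\<Union>k\<in>I. U k \<times> V k) < 1" .

  have UV_borel: "(\<Union>k\<in>I. U k \<times> V k) \<in> sets borel"
    by (rule UN_Times_borel[OF countableI_type]) (auto simp: U_def V_def)
  have "AE z in lebesgue. z \<in> unit_square \<longrightarrow> z \<in> (\<Union>k\<in>I. U k \<times> V k)"
    using diverges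
  proof eventually_elim
    case (elim z)
    show ?case
    proof (rule impI, rule ccontr)
      assume z: "z \<in> unit_square" "z \<notin> (\<Union>k\<in>I. U k \<times> V k)"
      have bound: "\<bar>dyadic_average f n m i j\<bar> \<le> 4 ^ K * M"
        if *: "n \<in> D" "m \<in> D" "i \<in> {1..2 ^ n}" "j \<in> {1..2 ^ m}" "M + K \<le> n" "M + K \<le> m" "z \<in> dyadic_rect n m i j"
        for n m i j
      proof -
        obtain n' where n': "n' \<in> C" "n \<le> n' + K" "n' \<le> n + K" using K[OF *(1)] by blast
        obtain m' where m': "m' \<in> C" "m \<le> m' + K" "m' \<le> m + K" using K[OF *(2)] by blast
        have "dyadic_average f n m i j \<le> 4 ^ K * real M"
        proof (rule dyadic_average_le_of_nearby[OF f n'(2) m'(2) *(3,4)])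
          fix i' j' assume ij': "i' \<in> {1..2 ^ n'}" "j' \<in> {1..2 ^ m'}"
            and ne: "dyadic_rect n m i j \<inter> dyadic_rect n' m' i' j' \<noteq> {}"
          show "dyadic_average f n' m' i' j' \<le> real M"
          proof (rule ccontr)
            assume "\<not> dyadic_average f n' m' i' j' \<le> real M"
            then have "(n', m', i', j') \<in> bad M"
              using n' m' ij' *(5,6) unfolding bad_def by auto
            then have "((n, m, i, j), (n', m', i', j')) \<in> I"
              using n'(3) m'(3) ne *(3,4) unfolding I_def by blast
            moreover have "z \<in> U ((n, m, i, j), (n', m', i', j')) \<times> V ((n, m, i, j), (n', m', i', j'))"
              using *(7) by (simp add: U_def V_def dyadic_rect_def)
            ultimately show False using z(2) by blast
          qed
        qed simp_all
        moreover have "0 \<le> dyadic_average f n m i j"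
        proof -
          have "0 \<le> indicator (dyadic_rect n m i j) w *\<^sub>R f w" for w
            using dyadic_rect_subset_unit_square[OF *(3,4)] f(2)[of w] by (auto simp: indicator_def)
          then show ?thesis
            unfolding dyadic_average_def set_lebesgue_integral_def
            by (intro divide_nonneg_nonneg integral_nonneg_AE) auto
        qed
        ultimately show ?thesis by simp
      qed
      then have "oscillation (dyadic_basis D) z f \<noteq> \<infinity>"
        by (intro oscillation_finiteI[where L="M + K" and B="4 ^ K * M"]) blast
      with elim z(1) show False by simp
    qed
  qed
  then have "emeasure lebesgue unit_square \<le> emeasure lebesgue (\<Union>k\<in>I. U k \<times> V k)"
    using UV_borel by (intro emeasure_mono_AE) (auto intro: lborelD)
  moreover have "emeasure lebesgue unit_square = 1"
    using measure_unit_square unit_square_lmeasurable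
    by (metis emeasure_eq_measure2 ennreal_1)
  ultimately show False
    using small UV_borel by simp
qed

section \<open>Independence of coarse and fine binary digits\<close>

text \<open>
  The set is determined by the integer part and the first \<open>n\<close> binary digits.
\<close>
definition coarse :: "nat \<Rightarrow> real set \<Rightarrow> bool" where
  "coarse n W \<longleftrightarrow> (\<forall>x x'. \<lfloor>2 ^ n * x\<rfloor> = \<lfloor>2 ^ n * x'\<rfloor> \<longrightarrow> (x \<in> W \<longleftrightarrow> x' \<in> W))"

text \<open>
  Having period \<open>2 ^ (- n)\<close> expresses that the set depends only on the binary digits after the
  \<open>n\<close>-th one.
\<close>
definition periodic :: "nat \<Rightarrow> real set \<Rightarrow> bool" where
  "periodic n W \<longleftrightarrow> (\<forall>x (i::int). (x + of_int i / 2 ^ n \<in> W) = (x \<in> W))"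

definition coarse2 :: "nat \<Rightarrow> nat \<Rightarrow> (real \<times> real) set \<Rightarrow> bool" where
  "coarse2 n m S \<longleftrightarrow> (\<forall>z z'. \<lfloor>2 ^ n * fst z\<rfloor> = \<lfloor>2 ^ n * fst z'\<rfloor> \<longrightarrow>
     \<lfloor>2 ^ m * snd z\<rfloor> = \<lfloor>2 ^ m * snd z'\<rfloor> \<longrightarrow> (z \<in> S \<longleftrightarrow> z' \<in> S))"

definition periodic2 :: "nat \<Rightarrow> nat \<Rightarrow> (real \<times> real) set \<Rightarrow> bool" where
  "periodic2 n m S \<longleftrightarrow> (\<forall>x y (i::int) (j::int).
     ((x + of_int i / 2 ^ n, y + of_int j / 2 ^ m) \<in> S) = ((x, y) \<in> S))"

lemma coarseD: "coarse n W \<Longrightarrow> \<lfloor>2 ^ n * x\<rfloor> = \<lfloor>2 ^ n * x'\<rfloor> \<Longrightarrow> x \<in> W \<longleftrightarrow> x' \<in> W"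
  unfolding coarse_def by blast

lemma coarse2D:
  "coarse2 n m S \<Longrightarrow> \<lfloor>2 ^ n * fst z\<rfloor> = \<lfloor>2 ^ n * fst z'\<rfloor> \<Longrightarrow> \<lfloor>2 ^ m * snd z\<rfloor> = \<lfloor>2 ^ m * snd z'\<rfloor> \<Longrightarrow>
    z \<in> S \<longleftrightarrow> z' \<in> S"
  unfolding coarse2_def by blast

lemma floor_eq_coarser:
  fixes x y :: real
  shows "\<lfloor>2 ^ q * x\<rfloor> = \<lfloor>2 ^ q * y\<rfloor> \<Longrightarrow> n \<le> q \<Longrightarrow> \<lfloor>2 ^ n * x\<rfloor> = \<lfloor>2 ^ n * y\<rfloor>"
  by (simp only: floor_finer[of n q])

lemma coarse_mono: "coarse n W \<Longrightarrow> n \<le> q \<Longrightarrow> coarse q W"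
  unfolding coarse_def by (intro allI impI) (drule floor_eq_coarser, assumption, blast)

lemma coarse2_mono: "coarse2 n m W \<Longrightarrow> n \<le> q \<Longrightarrow> m \<le> r \<Longrightarrow> coarse2 q r W"
  unfolding coarse2_def
  by (intro allI impI) (drule floor_eq_coarser, assumption, drule floor_eq_coarser, assumption, blast)

lemma coarser_period:
  assumes "n \<le> q"
  shows "of_int i / 2 ^ n = (of_int (i * 2 ^ (q - n)) / 2 ^ q :: real)"
  by (simp only: of_int_mult of_int_two_power_diff[OF assms]) simp

lemma periodic_mono: "periodic q W \<Longrightarrow> n \<le> q \<Longrightarrow> periodic n W"
  unfolding periodic_def by (simp only: coarser_period[of n q] simp_thms)

lemma coarse2_Times:
  "coarse n V \<Longrightarrow> coarse m W \<Longrightarrow> coarse2 n m (V \<times> W)"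
  unfolding coarse2_def coarse_def mem_Times_iff by blast

lemma periodic2_Times: "periodic n V \<Longrightarrow> periodic m W \<Longrightarrow> periodic2 n m (V \<times> W)"
  by (simp add: periodic2_def periodic_def)

lemma coarse_UNIV: "coarse n UNIV" and periodic_UNIV: "periodic n UNIV"
  by (auto simp: coarse_def periodic_def)

lemma coarse_Int: "coarse n V \<Longrightarrow> coarse n W \<Longrightarrow> coarse n (V \<inter> W)"
  unfolding coarse_def by blast

lemma coarse_Diff: "coarse n V \<Longrightarrow> coarse n W \<Longrightarrow> coarse n (V - W)"
  unfolding coarse_def by blast

lemma periodic_Int: "periodic n V \<Longrightarrow> periodic n W \<Longrightarrow> periodic n (V \<inter> W)"
  by (simp add: periodic_def)

lemma periodic_Diff: "periodic n V \<Longrightarrow> periodic n W \<Longrightarrow> periodic n (V - W)"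
  by (simp add: periodic_def)

lemma coarse_INT: "(\<And>t. t \<in> P \<Longrightarrow> coarse n (W t)) \<Longrightarrow> coarse n (\<Inter>t\<in>P. W t)"
  unfolding coarse_def by blast

lemma periodic_INT: "(\<And>t. t \<in> P \<Longrightarrow> periodic n (W t)) \<Longrightarrow> periodic n (\<Inter>t\<in>P. W t)"
  by (simp add: periodic_def)

lemma coarse2_UN: "(\<And>t. t \<in> P \<Longrightarrow> coarse2 n m (W t)) \<Longrightarrow> coarse2 n m (\<Union>t\<in>P. W t)"
  unfolding coarse2_def by blast

lemma periodic2_UN: "(\<And>t. t \<in> P \<Longrightarrow> periodic2 n m (W t)) \<Longrightarrow> periodic2 n m (\<Union>t\<in>P. W t)"
  by (simp add: periodic2_def)

lemma coarse2_INT: "(\<And>t. t \<in> P \<Longrightarrow> coarse2 n m (W t)) \<Longrightarrow> coarse2 n m (\<Inter>t\<in>P. W t)"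
  unfolding coarse2_def by blast

lemma coarse2_Compl: "coarse2 n m W \<Longrightarrow> coarse2 n m (- W)"
  unfolding coarse2_def by blast

lemma periodic2_Compl: "periodic2 n m W \<Longrightarrow> periodic2 n m (- W)"
  by (simp add: periodic2_def)

lemma floor_eq_borel: "{x::real. \<lfloor>2 ^ n * x\<rfloor> = i} \<in> sets borel"
proof -
  have "{x::real. \<lfloor>2 ^ n * x\<rfloor> = i} = {of_int i / 2 ^ n ..< (of_int i + 1) / 2 ^ n}"
    unfolding floor_eq_iff by (auto simp: field_simps)
  then show ?thesis by simp
qed

lemma coarse_borel:
  assumes "coarse n W"
  shows "W \<in> sets borel"
proof -
  have "W = (\<Union>i\<in>(\<lambda>x. \<lfloor>2 ^ n * x\<rfloor>) ` W. {x. \<lfloor>2 ^ n * x\<rfloor> = i})"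
  proof (intro equalityI subsetI)
    fix x :: real assume "x \<in> (\<Union>i\<in>(\<lambda>x. \<lfloor>2 ^ n * x\<rfloor>) ` W. {x. \<lfloor>2 ^ n * x\<rfloor> = i})"
    then obtain w where "w \<in> W" "\<lfloor>2 ^ n * x\<rfloor> = \<lfloor>2 ^ n * w\<rfloor>"
      by auto
    then show "x \<in> W"
      using coarseD[OF assms] by blast
  qed blast
  also have "\<dots> \<in> sets borel"
    by (intro sets.countable_UN'' countableI_type floor_eq_borel)
  finally show ?thesis .
qed

lemma coarse2_borel:
  assumes "coarse2 n m W"
  shows "W \<in> sets borel"
proof -
  let ?f = "\<lambda>z::real \<times> real. (\<lfloor>2 ^ n * fst z\<rfloor>, \<lfloor>2 ^ m * snd z\<rfloor>)"
  have "W = (\<Union>(i, j)\<in>?f ` W. {x::real. \<lfloor>2 ^ n * x\<rfloor> = i} \<times> {x::real. \<lfloor>2 ^ m * x\<rfloor> = j})"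
  proof (intro equalityI subsetI)
    fix z assume "z \<in> (\<Union>(i, j)\<in>?f ` W. {x::real. \<lfloor>2 ^ n * x\<rfloor> = i} \<times> {x::real. \<lfloor>2 ^ m * x\<rfloor> = j})"
    then obtain w where "w \<in> W" "\<lfloor>2 ^ n * fst z\<rfloor> = \<lfloor>2 ^ n * fst w\<rfloor>" "\<lfloor>2 ^ m * snd z\<rfloor> = \<lfloor>2 ^ m * snd w\<rfloor>"
      by auto
    then show "z \<in> W"
      using coarse2D[OF assms] by blast
  next
    fix z assume "z \<in> W"
    then show "z \<in> (\<Union>(i, j)\<in>?f ` W. {x::real. \<lfloor>2 ^ n * x\<rfloor> = i} \<times> {x::real. \<lfloor>2 ^ m * x\<rfloor> = j})"
      by (intro UN_I[of "?f z"]) (auto simp: mem_Times_iff)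
  qed
  also have "\<dots> \<in> sets borel"
  proof (intro sets.countable_UN'' countableI_type)
    show "(case p of (i, j) \<Rightarrow> {x::real. \<lfloor>2 ^ n * x\<rfloor> = i} \<times> {x::real. \<lfloor>2 ^ m * x\<rfloor> = j}) \<in> sets borel" for p
      by (cases p) (simp add: borel_prod[symmetric] pair_measureI floor_eq_borel)
  qed
  finally show ?thesis .
qed

lemma lmeasurable_dyadic_rect_Int:
  "T \<in> sets borel \<Longrightarrow> dyadic_rect n m i j \<inter> T \<in> lmeasurable"
  by (intro bounded_set_imp_lmeasurable lborelD sets.Int bounded_Int disjI1 bounded_dyadic_rect) simp_all

definition prob2 :: "(real \<times> real) set \<Rightarrow> real" where
  "prob2 S = measure lebesgue (unit_square \<inter> S)"

lemma dyadic_rect_disjoint: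
  "(i, j) \<noteq> (i', j') \<Longrightarrow> dyadic_rect n m i j \<inter> dyadic_rect n m i' j' = {}"
  by (auto simp: mem_dyadic_rect_iff)

lemma translation_Times: "(+) a ` A \<times> (+) b ` B = (+) (a, b) ` (A \<times> B)"
  by (auto simp: image_iff plus_prod_def)

text \<open>
  The rectangles of one shape are translates of each other by periods of \<open>T\<close>.
\<close>
lemma measure_dyadic_rect_periodic_eq:
  assumes "periodic2 n m T"
  shows "measure lebesgue (dyadic_rect n m i j \<inter> T) = measure lebesgue (dyadic_rect n m 1 1 \<inter> T)"
proof -
  let ?a = "((real i - 1) / 2 ^ n, (real j - 1) / 2 ^ m)"
  have T: "?a + z \<in> T \<longleftrightarrow> z \<in> T" for z
  proof -
    have "?a + z = (fst z + of_int (int i - 1) / 2 ^ n, snd z + of_int (int j - 1) / 2 ^ m)"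
      by (cases z) (simp add: add.commute)
    then show ?thesis
      using assms unfolding periodic2_def by (metis prod.collapse)
  qed
  have "dyadic_rect n m i j = (+) ?a ` dyadic_rect n m 1 1"
    unfolding dyadic_rect_def
    by (subst dyadic_interval_eq_translate[of n i], subst dyadic_interval_eq_translate[of m j])
       (rule translation_Times)
  then have "dyadic_rect n m i j \<inter> T = (+) ?a ` (dyadic_rect n m 1 1 \<inter> T)"
    by (auto simp only: Int_iff image_iff T)
  then show ?thesis
    by (simp only: measure_translation)
qed

text \<open>
  A coarse set is a union of rectangles of the given level, and each of them contains the same portion of
  \<open>T\<close>. Taking \<open>T\<close> or \<open>S\<close> to be the whole plane yields the independence lemma below.
\<close>
lemma prob2_coarse_periodic_count:
  assumes "coarse2 n m S" "periodic2 n m T" "T \<in> sets borel"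
  defines "I \<equiv> {(i, j). i \<in> {1..2 ^ n} \<and> j \<in> {1..2 ^ m} \<and> dyadic_rect n m i j \<subseteq> S}"
  shows "prob2 (S \<inter> T) = card I * measure lebesgue (dyadic_rect n m 1 1 \<inter> T)"
proof -
  have fin: "finite I"
    by (rule finite_subset[of _ "{1..2 ^ n} \<times> {1..2 ^ m}"]) (auto simp: I_def)
  have "unit_square \<inter> (S \<inter> T) = (\<Union>(i, j)\<in>I. dyadic_rect n m i j \<inter> T)"
  proof (intro equalityI subsetI)
    fix z assume z: "z \<in> unit_square \<inter> (S \<inter> T)"
    then obtain i j where ij: "i \<in> {1..2 ^ n}" "j \<in> {1..2 ^ m}" "z \<in> dyadic_rect n m i j"
      using unit_square_dyadic_cover[of z n m] by blast
    have "dyadic_rect n m i j \<subseteq> S"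
    proof
      fix w assume "w \<in> dyadic_rect n m i j"
      with ij(3) have "z \<in> S \<longleftrightarrow> w \<in> S"
        by (intro coarse2D[OF assms(1)]) (simp_all add: mem_dyadic_rect_iff)
      with z show "w \<in> S" by simp
    qed
    then show "z \<in> (\<Union>(i, j)\<in>I. dyadic_rect n m i j \<inter> T)"
      using z ij by (auto simp: I_def)
  next
    fix z assume "z \<in> (\<Union>(i, j)\<in>I. dyadic_rect n m i j \<inter> T)"
    then show "z \<in> unit_square \<inter> (S \<inter> T)"
      using dyadic_rect_subset_unit_square unfolding I_def by blast
  qed
  then have "prob2 (S \<inter> T) = measure lebesgue (\<Union>(i, j)\<in>I. dyadic_rect n m i j \<inter> T)"
    by (simp add: prob2_def)
  also have "\<dots> = (\<Sum>p\<in>I. measure lebesgue (case p of (i, j) \<Rightarrow> dyadic_rect n m i j \<inter> T))"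
  proof (intro measure_UNION'[OF fin] pairwiseI)
    show "(case p of (i, j) \<Rightarrow> dyadic_rect n m i j \<inter> T) \<in> lmeasurable" for p
      using assms(3) by (cases p) (simp add: lmeasurable_dyadic_rect_Int)
    show "disjnt (case p of (i, j) \<Rightarrow> dyadic_rect n m i j \<inter> T) (case p' of (i, j) \<Rightarrow> dyadic_rect n m i j \<inter> T)"
      if "p \<noteq> p'" for p p'
      using that dyadic_rect_disjoint[of "fst p" "snd p" "fst p'" "snd p'" n m]
      by (cases p; cases p') (auto simp: disjnt_def)
  qed
  also have "\<dots> = (\<Sum>p\<in>I. measure lebesgue (dyadic_rect n m 1 1 \<inter> T))"
    by (intro sum.cong refl) (unfold split_beta, rule measure_dyadic_rect_periodic_eq[OF assms(2)])
  finally show ?thesis by simp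
qed

lemma measure_dyadic_rect_Int_periodic:
  assumes "periodic2 n m T" "T \<in> sets borel"
  shows "measure lebesgue (dyadic_rect n m i j \<inter> T) = prob2 T / 2 ^ (n + m)"
proof -
  have "{(i, j). i \<in> {1..2 ^ n} \<and> j \<in> {1..2 ^ m} \<and> dyadic_rect n m i j \<subseteq> UNIV} = {1..2 ^ n} \<times> {1..2 ^ m}"
    by auto
  then have "prob2 T = 2 ^ (n + m) * measure lebesgue (dyadic_rect n m 1 1 \<inter> T)"
    using prob2_coarse_periodic_count[of n m UNIV T] assms by (simp add: coarse2_def power_add)
  then show ?thesis
    using measure_dyadic_rect_periodic_eq[OF assms(1), of i j] by simp
qed

lemma prob2_UNIV: "prob2 UNIV = 1"
  by (simp add: prob2_def measure_unit_square)

text \<open>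
  By the count above, both sides are the number of rectangles contained in \<open>S\<close> times the measure of
  the portion of \<open>T\<close> in one of them.
\<close>
lemma prob2_indep:
  assumes "coarse2 n m S" "periodic2 n m T" "T \<in> sets borel"
  shows "prob2 (S \<inter> T) = prob2 S * prob2 T"
proof -
  have "prob2 (S \<inter> T) * 2 ^ (n + m) = prob2 (S \<inter> UNIV) * 2 ^ (n + m) * prob2 T"
    using measure_dyadic_rect_Int_periodic[OF assms(2,3), of 1 1]
      prob2_coarse_periodic_count[OF assms(1,2,3)] prob2_coarse_periodic_count[OF assms(1), of UNIV]
    by (simp add: measure_dyadic_rect periodic2_def)
  then show ?thesis by simp
qed

text \<open>
  Within a rectangle of the level of \<open>S\<close> the digits that decide membership in \<open>S\<close> are fixed
  and the digits that decide membership in \<open>T\<close> are free. All averages in the construction are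
  computed in this way.
\<close>
lemma measure_dyadic_rect_Int:
  assumes "coarse2 n m S" "periodic2 n m T" "T \<in> sets borel" "z \<in> dyadic_rect n m i j"
  shows "measure lebesgue (dyadic_rect n m i j \<inter> (S \<inter> T)) / measure lebesgue (dyadic_rect n m i j) =
         (if z \<in> S then prob2 T else 0)"
proof -
  have "w \<in> S \<longleftrightarrow> z \<in> S" if "w \<in> dyadic_rect n m i j" for w
    using assms(4) that by (intro coarse2D[OF assms(1)]) (simp_all add: mem_dyadic_rect_iff)
  then have "dyadic_rect n m i j \<inter> (S \<inter> T) = (if z \<in> S then dyadic_rect n m i j \<inter> T else {})"
    by auto
  then show ?thesis
    using measure_dyadic_rect_Int_periodic[OF assms(2,3), of i j] by (simp add: measure_dyadic_rect)
qed

definition prob1 :: "real set \<Rightarrow> real" where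
  "prob1 W = measure lebesgue ({0..<1} \<inter> W)"

lemma prob2_Times:
  assumes "V \<in> sets borel" "W \<in> sets borel"
  shows "prob2 (V \<times> W) = prob1 V * prob1 W"
proof -
  have fin: "emeasure lborel ({0..<1} \<inter> V) < \<infinity>" if "V \<in> sets borel" for V :: "real set"
  proof -
    have "emeasure lborel ({0..<1} \<inter> V) \<le> emeasure lborel {0..<1::real}"
      using that by (intro emeasure_mono) auto
    also have "\<dots> < \<infinity>" by simp
    finally show ?thesis .
  qed
  have "unit_square \<inter> V \<times> W = ({0..<1} \<inter> V) \<times> ({0..<1} \<inter> W)"
    by (auto simp: unit_square_def)
  then show ?thesis
    using assms fin unfolding prob2_def prob1_def by (simp only:) (intro measure_Times_borel; simp)
qed

lemma prob1_UNIV: "prob1 UNIV = 1"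
  by (simp add: prob1_def measure_completion)

text \<open>
  The planar statement for vertical strips.
\<close>
lemma prob1_indep:
  assumes "coarse n V" "periodic n W" "W \<in> sets borel"
  shows "prob1 (V \<inter> W) = prob1 V * prob1 W"
proof -
  have "prob2 ((V \<times> UNIV) \<inter> (W \<times> UNIV)) = prob2 (V \<times> UNIV) * prob2 (W \<times> UNIV)"
    using assms by (intro prob2_indep[of n 0] coarse2_Times periodic2_Times coarse_UNIV periodic_UNIV Times_borel) auto
  moreover have "(V \<times> (UNIV::real set)) \<inter> (W \<times> UNIV) = (V \<inter> W) \<times> UNIV" by auto
  ultimately show ?thesis
    using assms coarse_borel[OF assms(1)] by (simp add: prob2_Times prob1_UNIV sets.Int)
qed

lemma prob1_periodic_eq:
  assumes "periodic n W" "W \<in> sets borel"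
  shows "prob1 W = 2 ^ n * measure lebesgue (dyadic_interval n 1 \<inter> W)"
proof -
  have "prob1 (dyadic_interval n 1 \<inter> W) = prob1 (dyadic_interval n 1) * prob1 W"
    using assms by (intro prob1_indep[of n]) (auto simp: coarse_def mem_dyadic_interval_iff)
  moreover have "{0..<1} \<inter> dyadic_interval n 1 = dyadic_interval n 1"
    using dyadic_interval_subset_unit[of 1 n] by auto
  ultimately show ?thesis
    by (simp add: prob1_def measure_dyadic_interval Int_assoc[symmetric])
qed

text \<open>
  The numbers whose binary digits at the positions \<open>p + 1, ..., q\<close> all vanish.
\<close>
definition zero_bits :: "nat \<Rightarrow> nat \<Rightarrow> real set" where
  "zero_bits p q = {x. \<lfloor>2 ^ q * x\<rfloor> mod 2 ^ (q - p) = 0}"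

lemma coarse_zero_bits: "coarse q (zero_bits p q)"
  by (simp add: coarse_def zero_bits_def)

lemma periodic_zero_bits:
  assumes "p \<le> q"
  shows "periodic p (zero_bits p q)"
proof -
  have "\<lfloor>2 ^ q * (x + of_int i / 2 ^ p)\<rfloor> = \<lfloor>2 ^ q * x\<rfloor> + i * 2 ^ (q - p)" for x :: real and i :: int
  proof -
    have "2 ^ q * (x + of_int i / 2 ^ p) = 2 ^ q * x + of_int (i * 2 ^ (q - p))"
      by (simp only: coarser_period[OF assms]) (simp add: distrib_left)
    then show ?thesis
      by (simp only: floor_add_int[symmetric])
  qed
  then show ?thesis
    by (simp add: periodic_def zero_bits_def)
qed

lemma prob1_zero_bits:
  assumes "p \<le> q"
  shows "prob1 (zero_bits p q) = 1 / 2 ^ (q - p)"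
proof -
  have "dyadic_interval p 1 \<inter> zero_bits p q = dyadic_interval q 1"
  proof -
    have "a div b = 0 \<and> a mod b = 0 \<longleftrightarrow> a = 0" for a b :: int
      by (metis div_0 div_mod_decomp_int mod_0 mult_zero_left add_0)
    then show ?thesis
      unfolding set_eq_iff Int_iff mem_dyadic_interval_iff zero_bits_def mem_Collect_eq floor_finer[OF assms]
      by simp
  qed
  then show ?thesis
    using assms by (subst prob1_periodic_eq[of p])
      (auto simp: periodic_zero_bits measure_dyadic_interval power_diff intro: coarse_borel[OF coarse_zero_bits])
qed

text \<open>
  Event \<open>t\<close> involves only digits at positions between \<open>lo t\<close> and \<open>hi t\<close>, and these
  ranges do not overlap, so the events are independent by induction on the last group.
\<close>
lemma prob1_digit_groups:
  assumes "finite P"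
    and "\<And>t. t \<in> P \<Longrightarrow> coarse (hi t) (W t)" "\<And>t. t \<in> P \<Longrightarrow> periodic (lo t) (W t)"
    and "\<And>s t. s \<in> P \<Longrightarrow> t \<in> P \<Longrightarrow> s < t \<Longrightarrow> hi s \<le> lo (t::nat)"
  shows "prob1 (\<Inter>t\<in>P. W t) = (\<Prod>t\<in>P. prob1 (W t))"
  using assms
proof (induction P rule: finite_linorder_max_induct)
  case empty
  then show ?case by (simp add: prob1_UNIV)
next
  case (insert t P)
  have IH: "prob1 (\<Inter>s\<in>P. W s) = (\<Prod>s\<in>P. prob1 (W s))"
  proof (rule insert.IH)
    show "coarse (hi s) (W s)" if "s \<in> P" for s by (rule insert.prems(1)) (use that in simp)
    show "periodic (lo s) (W s)" if "s \<in> P" for s by (rule insert.prems(2)) (use that in simp)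
    show "hi r \<le> lo s" if "r \<in> P" "s \<in> P" "r < s" for r s
      by (rule insert.prems(3)) (use that in auto)
  qed
  have "prob1 ((\<Inter>s\<in>P. W s) \<inter> W t) = prob1 (\<Inter>s\<in>P. W s) * prob1 (W t)"
  proof (rule prob1_indep)
    show "coarse (lo t) (\<Inter>s\<in>P. W s)"
    proof (rule coarse_INT)
      fix s assume s: "s \<in> P"
      have "hi s \<le> lo t"
        by (rule insert.prems(3)) (use s insert.hyps(2) in simp_all)
      moreover have "coarse (hi s) (W s)"
        by (rule insert.prems(1)) (use s in simp)
      ultimately show "coarse (lo t) (W s)"
        by (rule coarse_mono[rotated])
    qed
    show "periodic (lo t) (W t)" by (rule insert.prems(2)) simp
    show "W t \<in> sets borel" by (rule coarse_borel[of "hi t"], rule insert.prems(1)) simp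
  qed
  moreover have "(\<Inter>s\<in>insert t P. W s) = (\<Inter>s\<in>P. W s) \<inter> W t"
    by blast
  moreover have "t \<notin> P"
    using insert.hyps(2) by blast
  ultimately show ?case
    using IH insert.hyps(1) by (simp add: mult.commute)
qed

lemma prob1_Diff:
  assumes "V \<in> sets borel" "W \<in> sets borel"
  shows "prob1 (V - W) = prob1 V - prob1 (V \<inter> W)"
proof -
  have m: "{0..<1} \<inter> U \<in> lmeasurable" if "U \<in> sets borel" for U :: "real set"
    using that by (intro bounded_set_imp_lmeasurable lborelD bounded_Int) auto
  have "{0..<1} \<inter> (V - W) = ({0..<1} \<inter> V) - ({0..<1} \<inter> (V \<inter> W))"
    by auto
  then show ?thesis
    unfolding prob1_def using assms by (simp only:) (intro measurable_measure_Diff; auto intro!: m lborelD)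
qed

lemma prob2_lmeasurable: "S \<in> sets borel \<Longrightarrow> unit_square \<inter> S \<in> lmeasurable"
  by (intro bounded_set_imp_lmeasurable lborelD sets.Int bounded_Int disjI1 bounded_unit_square) simp_all

lemma prob2_Compl:
  assumes "S \<in> sets borel"
  shows "prob2 (- S) = 1 - prob2 S"
proof -
  have "unit_square \<inter> - S = unit_square - (unit_square \<inter> S)" by auto
  moreover have "measure lebesgue (unit_square - (unit_square \<inter> S)) =
      measure lebesgue unit_square - measure lebesgue (unit_square \<inter> S)"
    using assms by (intro measurable_measure_Diff unit_square_lmeasurable) (auto intro!: lborelD)
  ultimately show ?thesis
    by (simp only: prob2_def measure_unit_square)
qed

lemma prob2_UN_le:
  assumes "finite I" "\<And>k. k \<in> I \<Longrightarrow> S k \<in> sets borel"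
  shows "prob2 (\<Union>k\<in>I. S k) \<le> (\<Sum>k\<in>I. prob2 (S k))"
proof -
  have "unit_square \<inter> (\<Union>k\<in>I. S k) = (\<Union>k\<in>I. unit_square \<inter> S k)" by auto
  then show ?thesis
    unfolding prob2_def using assms by (simp only:) (intro measure_UNION_le; auto intro!: lborelD)
qed

lemma prob2_UN_disjoint:
  assumes "finite I" "\<And>k. k \<in> I \<Longrightarrow> S k \<in> sets borel" "pairwise (\<lambda>k l. S k \<inter> S l = {}) I"
  shows "prob2 (\<Union>k\<in>I. S k) = (\<Sum>k\<in>I. prob2 (S k))"
proof -
  have "unit_square \<inter> (\<Union>k\<in>I. S k) = (\<Union>k\<in>I. unit_square \<inter> S k)" by auto
  moreover have "measure lebesgue (\<Union>k\<in>I. unit_square \<inter> S k) = (\<Sum>k\<in>I. measure lebesgue (unit_square \<inter> S k))"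
    using assms(3) by (intro measure_UNION' assms(1) prob2_lmeasurable assms(2)) (auto simp: pairwise_def disjnt_def)
  ultimately show ?thesis
    by (simp only: prob2_def)
qed

lemma measure_dyadic_rect_Int_product:
  assumes "z \<in> dyadic_rect n m i j"
    and "coarse n S1" "periodic n T1" "T1 \<in> sets borel"
    and "coarse m S2" "periodic m T2" "T2 \<in> sets borel"
  shows "measure lebesgue (dyadic_rect n m i j \<inter> (S1 \<inter> T1) \<times> (S2 \<inter> T2)) / measure lebesgue (dyadic_rect n m i j) =
         (if z \<in> S1 \<times> S2 then prob1 T1 * prob1 T2 else 0)"
proof -
  have "(S1 \<inter> T1) \<times> (S2 \<inter> T2) = (S1 \<times> S2) \<inter> (T1 \<times> T2)" by auto
  then show ?thesis
    using measure_dyadic_rect_Int[OF coarse2_Times[OF assms(2,5)] periodic2_Times[OF assms(3,6)]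
        Times_borel[OF assms(4,7)] assms(1)]
    by (simp only: prob2_Times[OF assms(4,7)])
qed

section \<open>Spikes built from digit windows\<close>

text \<open>
  Around each level \<open>d t\<close> there is a window of positions from \<open>d t - u\<close> to \<open>d t + v\<close>
  whose interior contains no element of \<open>C\<close>; the windows do not overlap.
\<close>
locale digit_scales =
  fixes C :: "nat set" and d :: "nat \<Rightarrow> nat" and u v M :: nat
  assumes room: "u \<le> d 0"
    and separated: "d t + v + u \<le> d (Suc t)"
    and gap: "n \<in> C \<Longrightarrow> n + u \<le> d t \<or> d t + v \<le> n"
    and v_pos: "0 < v"
begin

text \<open>
  The number of windows used by one spike. Of these, \<open>M\<close> full windows are shared between the two
  coordinates of a rectangle along which the spike has a large average.
\<close>
definition N :: nat where "N = M + 2"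
definition a :: real where "a = 1 / 2 ^ u"
definition b :: real where "b = 1 / 2 ^ v"
definition \<alpha> :: real where "\<alpha> = a * b"

definition A :: "nat \<Rightarrow> real set" where "A t = zero_bits (d t - u) (d t)"
definition B :: "nat \<Rightarrow> real set" where "B t = zero_bits (d t) (d t + v)"
definition X :: "nat \<Rightarrow> real set" where "X t = A t \<inter> B t"

lemma a_bounds: "0 < a" "a \<le> 1" and b_bounds: "0 < b" "b \<le> 1 / 2" and \<alpha>_bounds: "0 < \<alpha>" "\<alpha> \<le> 1"
proof -
  show a: "0 < a" "a \<le> 1" by (auto simp: a_def)
  have "(2::real) ^ 1 \<le> 2 ^ v" using v_pos by (intro power_increasing) auto
  then show b: "0 < b" "b \<le> 1 / 2" by (auto simp: b_def field_simps)
  show "0 < \<alpha>" using a b by (simp add: \<alpha>_def)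
  have "a * b \<le> 1 * 1" using a b by (intro mult_mono) auto
  then show "\<alpha> \<le> 1" by (simp add: \<alpha>_def)
qed

lemma d_ge_u: "u \<le> d t"
proof (induction t)
  case (Suc t)
  then show ?case using separated[of t] by linarith
qed (rule room)

lemma separated_lt: "s < t \<Longrightarrow> d s + v \<le> d t - u"
proof (induction t)
  case (Suc t)
  then show ?case
    using separated[of t] d_ge_u[of t] by (cases "s = t") auto
qed simp

lemma d_strict_mono: "s < t \<Longrightarrow> d s < d t"
  using separated_lt[of s t] v_pos by linarith

lemma d_mono: "s \<le> t \<Longrightarrow> d s \<le> d t"
  using d_strict_mono[of s t] by (cases "s = t") auto

lemma A_digits: "coarse (d t) (A t)" "periodic (d t - u) (A t)"
  by (simp_all add: A_def coarse_zero_bits periodic_zero_bits)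

lemma B_digits: "coarse (d t + v) (B t)" "periodic (d t) (B t)"
  by (simp_all add: B_def coarse_zero_bits periodic_zero_bits)

lemma X_digits: "coarse (d t + v) (X t)" "periodic (d t - u) (X t)"
proof -
  show "coarse (d t + v) (X t)"
    unfolding X_def by (rule coarse_Int[OF coarse_mono[OF A_digits(1)] B_digits(1)]) simp
  show "periodic (d t - u) (X t)"
    unfolding X_def by (rule periodic_Int[OF A_digits(2) periodic_mono[OF B_digits(2)]]) simp
qed

lemmas A_borel = coarse_borel[OF A_digits(1)]
lemmas B_borel = coarse_borel[OF B_digits(1)]

lemma prob1_A: "prob1 (A t) = a"
  using d_ge_u[of t] by (simp add: A_def prob1_zero_bits a_def)

lemma prob1_B: "prob1 (B t) = b"
  by (simp add: B_def prob1_zero_bits b_def)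

lemma prob1_X: "prob1 (X t) = \<alpha>"
  unfolding X_def by (simp only: prob1_indep[OF A_digits(1) B_digits(2) B_borel] prob1_A prob1_B \<alpha>_def)

lemma prob1_A_minus_B: "prob1 (A t - B t) = a * (1 - b)"
  by (simp only: prob1_Diff[OF A_borel B_borel] prob1_A X_def[symmetric] prob1_X \<alpha>_def right_diff_distrib mult_1_right)

lemma prob1_INT_X: "finite P \<Longrightarrow> prob1 (\<Inter>t\<in>P. X t) = \<alpha> ^ card P"
  using X_digits separated_lt
  by (subst prob1_digit_groups[where hi="\<lambda>t. d t + v" and lo="\<lambda>t. d t - u"]) (simp_all add: prob1_X)

text \<open>
  Windows are grouped into blocks of length \<open>N\<close>, and block \<open>r\<close> carries the \<open>r\<close>-th copy of
  the spike. The two definitions impose the condition \<open>X\<close> on the first \<open>k\<close> windows of the block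
  and on the remaining ones.
\<close>
definition pre :: "nat \<Rightarrow> nat \<Rightarrow> real set" where
  "pre r k = (\<Inter>t\<in>{r * N..<r * N + k}. X t)"

definition post :: "nat \<Rightarrow> nat \<Rightarrow> real set" where
  "post r k = (\<Inter>t\<in>{r * N + k..<r * N + N}. X t)"

lemma pre_post: "k \<le> N \<Longrightarrow> pre r N = pre r k \<inter> post r k"
proof -
  assume "k \<le> N"
  then have "{r * N..<r * N + N} = {r * N..<r * N + k} \<union> {r * N + k..<r * N + N}" by auto
  then show ?thesis unfolding pre_def post_def by blast
qed

lemma pre_antimono: "k \<le> l \<Longrightarrow> pre r l \<subseteq> pre r k"
  unfolding pre_def by (intro INT_anti_mono) auto

lemma coarse_pre:
  assumes "\<And>t. t < r * N + k \<Longrightarrow> d t + v \<le> n"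
  shows "coarse n (pre r k)"
  unfolding pre_def
proof (rule coarse_INT)
  fix t assume "t \<in> {r * N..<r * N + k}"
  then show "coarse n (X t)"
    by (intro coarse_mono[OF X_digits(1)] assms) simp
qed

lemma coarse_pre': "coarse (d (r * N + k) - u) (pre r k)"
  by (rule coarse_pre) (rule separated_lt)

lemma pre_borel: "pre r k \<in> sets borel"
  by (rule coarse_borel[OF coarse_pre'])

lemma periodic_pre: "periodic (d (r * N) - u) (pre r k)"
  unfolding pre_def
proof (rule periodic_INT)
  fix t assume "t \<in> {r * N..<r * N + k}"
  then show "periodic (d (r * N) - u) (X t)"
    by (intro periodic_mono[OF X_digits(2)] diff_le_mono d_mono) simp
qed

lemma post_borel: "post r k \<in> sets borel"
proof -
  have "coarse (d (r * N + N) - u) (post r k)"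
    unfolding post_def
  proof (rule coarse_INT)
    fix t assume "t \<in> {r * N + k..<r * N + N}"
    then show "coarse (d (r * N + N) - u) (X t)"
      by (intro coarse_mono[OF X_digits(1)] separated_lt) simp
  qed
  then show ?thesis by (rule coarse_borel)
qed

lemma periodic_post:
  assumes "\<And>t. r * N + k \<le> t \<Longrightarrow> n \<le> d t - u"
  shows "periodic n (post r k)"
  unfolding post_def
proof (rule periodic_INT)
  fix t assume "t \<in> {r * N + k..<r * N + N}"
  then show "periodic n (X t)"
    by (intro periodic_mono[OF X_digits(2)] assms) simp
qed

lemma prob1_pre: "prob1 (pre r k) = \<alpha> ^ k"
  unfolding pre_def by (subst prob1_INT_X) auto

lemma prob1_post: "prob1 (post r k) = \<alpha> ^ (N - k)"
  unfolding post_def by (subst prob1_INT_X) auto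

definition spike :: "nat \<Rightarrow> (real \<times> real) set" where
  "spike r = pre r N \<times> pre r N"

text \<open>
  The union of the rectangles that have passed \<open>M + 1\<close> full windows, distributed in all possible ways over
  the two coordinates. Off this set every \<open>C\<close>-average of the spike is small.
\<close>
definition bad :: "nat \<Rightarrow> (real \<times> real) set" where
  "bad r = (\<Union>k\<in>{..M + 1}. pre r k \<times> pre r (M + 1 - k))"

text \<open>
  The points of the rectangle of level \<open>d (r N + k)\<close> by \<open>d (r N + M - k)\<close> on which the last window
  is only half passed in both coordinates. Excluding \<open>B\<close> in the first coordinate makes the parts
  for different \<open>k\<close> disjoint, because \<open>k\<close> is then the first window at which \<open>X\<close> fails.
\<close>
definition good_part :: "nat \<Rightarrow> nat \<Rightarrow> (real \<times> real) set" where
  "good_part r k = (pre r k \<inter> (A (r * N + k) - B (r * N + k))) \<times> (pre r (M - k) \<inter> A (r * N + (M - k)))"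

definition good :: "nat \<Rightarrow> (real \<times> real) set" where
  "good r = (\<Union>k\<in>{..M}. good_part r k)"

text \<open>
  The number of windows that are completely resolved at level \<open>n\<close>.
\<close>
definition passed :: "nat \<Rightarrow> nat" where
  "passed n = (LEAST t. n < d t + v)"

lemma passed_iff: "d t + v \<le> n \<longleftrightarrow> t < passed n"
proof -
  have ge: "t \<le> d t" for t
  proof (induction t)
    case (Suc t)
    then show ?case using d_strict_mono[of t "Suc t"] by simp
  qed simp
  have "n < d n + v" using ge[of n] v_pos by linarith
  then have "n < d (passed n) + v"
    unfolding passed_def by (rule LeastI)
  moreover have "\<not> n < d t + v" if "t < passed n"
    using that unfolding passed_def by (rule not_less_Least)
  ultimately show ?thesis
    using d_mono[of "passed n" t] by (cases "t < passed n") auto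
qed

text \<open>
  A level of \<open>C\<close> does not lie inside a window, so it splits the windows of a block into resolved and
  untouched ones.
\<close>
lemma pre_split_at_C_level:
  fixes r
  assumes "n \<in> C"
  defines "k \<equiv> min N (passed n - r * N)"
  shows "pre r N = pre r k \<inter> post r k" "coarse n (pre r k)" "periodic n (post r k)"
proof -
  show "pre r N = pre r k \<inter> post r k"
    by (rule pre_post) (simp add: k_def)
  show "coarse n (pre r k)"
  proof (cases "k = 0")
    case True
    then show ?thesis by (simp add: pre_def coarse_UNIV)
  next
    case False
    then show ?thesis
      by (intro coarse_pre) (auto simp: passed_iff k_def min_def split: if_splits)
  qed
  show "periodic n (post r k)"
  proof (cases "k = N")
    case True
    then show ?thesis by (simp add: post_def periodic_UNIV)
  next
    case False
    have "n \<le> d t - u" if "r * N + k \<le> t" for t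
    proof -
      have "\<not> d t + v \<le> n"
        using that False by (simp add: passed_iff k_def min_def split: if_splits)
      then show ?thesis
        using gap[OF assms(1), of t] by linarith
    qed
    then show ?thesis by (rule periodic_post)
  qed
qed

text \<open>
  If \<open>k\<close> and \<open>l\<close> windows of the block are resolved in the two coordinates, the average is
  \<open>\<alpha> ^ (2 N - k - l)\<close> or \<open>0\<close>. Off the bad set it vanishes once \<open>k + l > M\<close>; in
  particular the block is then not completely passed by either coordinate. The average can exceed its
  initial value \<open>\<alpha> ^ (2 N)\<close> only if some but not all windows of the block are resolved in the finer
  coordinate, which singles out one block for each rectangle.
\<close>
lemma spike_average_at_C_levels:
  assumes "n \<in> C" "m \<in> C" "z \<in> dyadic_rect n m i j" "z \<notin> bad r"
  shows "measure lebesgue (dyadic_rect n m i j \<inter> spike r) / measure lebesgue (dyadic_rect n m i j)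
    \<le> \<alpha> ^ (2 * N) + (if r = max (passed n) (passed m) div N then \<alpha> ^ (M + 4) else 0)"
    (is "?avg \<le> _")
proof -
  define k where "k = min N (passed n - r * N)"
  define l where "l = min N (passed m - r * N)"
  note K = pre_split_at_C_level[OF assms(1), of r, folded k_def]
  note L = pre_split_at_C_level[OF assms(2), of r, folded l_def]
  have sp: "spike r = (pre r k \<inter> post r k) \<times> (pre r l \<inter> post r l)"
    by (simp only: spike_def K(1)[symmetric] L(1)[symmetric])
  have avg: "?avg = (if z \<in> pre r k \<times> pre r l then \<alpha> ^ (N - k) * \<alpha> ^ (N - l) else 0)"
    unfolding sp measure_dyadic_rect_Int_product[OF assms(3) K(2,3) post_borel L(2,3) post_borel] prob1_post ..
  show ?thesis
  proof (cases "z \<in> pre r k \<times> pre r l")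
    case False
    then have "?avg = 0" using avg by (simp only: if_False)
    then show ?thesis
      using \<alpha>_bounds by (simp only:) auto
  next
    case True
    have kl: "k + l \<le> M"
    proof (rule ccontr)
      assume "\<not> k + l \<le> M"
      then have "min k (M + 1) \<le> k" "M + 1 - min k (M + 1) \<le> l" by auto
      with True have "z \<in> pre r (min k (M + 1)) \<times> pre r (M + 1 - min k (M + 1))"
        using pre_antimono by blast
      then have "z \<in> bad r" unfolding bad_def by (intro UN_I) auto
      with assms(4) show False ..
    qed
    then have avg': "?avg = \<alpha> ^ (2 * N - (k + l))"
    proof -
      have "2 * N - (k + l) = (N - k) + (N - l)"
        using kl by (simp add: N_def)
      then show ?thesis
        using avg True by (simp only: if_True power_add)
    qed
    show ?thesis
    proof (cases "k + l = 0")
      case True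
      then show ?thesis unfolding avg' using \<alpha>_bounds by simp
    next
      case False
      have "r * N \<le> max (passed n) (passed m)" "max (passed n) (passed m) < r * N + N"
        using False kl by (auto simp: k_def l_def N_def min_def split: if_splits)
      then have "max (passed n) (passed m) div N = r"
        by (intro div_nat_eqI) (auto simp: algebra_simps)
      moreover have "\<alpha> ^ (2 * N - (k + l)) \<le> \<alpha> ^ (M + 4)"
        using kl \<alpha>_bounds by (intro power_decreasing) (auto simp: N_def)
      ultimately show ?thesis
        unfolding avg' using \<alpha>_bounds by (simp add: add_increasing)
    qed
  qed
qed

text \<open>
  The larger term occurs for one value of \<open>r\<close> only, so it enters the sum once and not \<open>K\<close> times.
\<close>
lemma spikes_average_at_C_levels:
  assumes "n \<in> C" "m \<in> C" "z \<in> dyadic_rect n m i j" "\<And>r. r < K \<Longrightarrow> z \<notin> bad r"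
  shows "(\<Sum>r<K. measure lebesgue (dyadic_rect n m i j \<inter> spike r) / measure lebesgue (dyadic_rect n m i j))
    \<le> K * \<alpha> ^ (2 * N) + \<alpha> ^ (M + 4)"
proof -
  have "(\<Sum>r<K. measure lebesgue (dyadic_rect n m i j \<inter> spike r) / measure lebesgue (dyadic_rect n m i j))
    \<le> (\<Sum>r<K. \<alpha> ^ (2 * N) + (if r = max (passed n) (passed m) div N then \<alpha> ^ (M + 4) else 0))"
    using assms by (intro sum_mono spike_average_at_C_levels) auto
  also have "\<dots> \<le> K * \<alpha> ^ (2 * N) + \<alpha> ^ (M + 4)"
    using \<alpha>_bounds by (simp add: sum.distrib)
  finally show ?thesis .
qed

text \<open>
  At a level \<open>d t\<close> the condition \<open>A\<close> of the current window is already satisfied and only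
  \<open>B\<close> and the later windows remain. In comparison with the \<open>C\<close>-rectangles that have passed
  \<open>M\<close> full windows this gains a factor \<open>1 / a\<close> in each coordinate.
\<close>
lemma spike_average_on_good:
  assumes "z \<in> good_part r k" "k \<le> M" "z \<in> dyadic_rect (d (r * N + k)) (d (r * N + (M - k))) i j"
  defines "R \<equiv> dyadic_rect (d (r * N + k)) (d (r * N + (M - k))) i j"
  shows "measure lebesgue (R \<inter> spike r) / measure lebesgue R = b ^ 2 * \<alpha> ^ (M + 2)"
proof -
  have split: "pre r N = (pre r k \<inter> A (r * N + k)) \<inter> (B (r * N + k) \<inter> post r (Suc k))"
    and co: "coarse (d (r * N + k)) (pre r k \<inter> A (r * N + k))"
    and pe: "periodic (d (r * N + k)) (B (r * N + k) \<inter> post r (Suc k))"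
    and bo: "B (r * N + k) \<inter> post r (Suc k) \<in> sets borel"
    and pr: "prob1 (B (r * N + k) \<inter> post r (Suc k)) = b * \<alpha> ^ (N - Suc k)"
    if "k \<le> M" for k
  proof -
    have "{r * N..<r * N + Suc k} = insert (r * N + k) {r * N..<r * N + k}" by auto
    then have "pre r (Suc k) = X (r * N + k) \<inter> pre r k"
      by (simp add: pre_def)
    moreover have "pre r N = pre r (Suc k) \<inter> post r (Suc k)"
      by (rule pre_post) (use that in \<open>simp add: N_def\<close>)
    ultimately show "pre r N = (pre r k \<inter> A (r * N + k)) \<inter> (B (r * N + k) \<inter> post r (Suc k))"
      by (auto simp: X_def)
    show "coarse (d (r * N + k)) (pre r k \<inter> A (r * N + k))"
      by (intro coarse_Int A_digits(1) coarse_mono[OF coarse_pre']) simp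
    have later: "d (r * N + k) + v \<le> d t - u" if "r * N + Suc k \<le> t" for t
      by (rule separated_lt) (use that in simp)
    show "periodic (d (r * N + k)) (B (r * N + k) \<inter> post r (Suc k))"
      using later by (intro periodic_Int B_digits(2) periodic_post) (meson add_leD1)
    show "B (r * N + k) \<inter> post r (Suc k) \<in> sets borel"
      by (intro sets.Int B_borel post_borel)
    have "periodic (d (r * N + k) + v) (post r (Suc k))"
      by (rule periodic_post) (rule later)
    from prob1_indep[OF B_digits(1) this post_borel]
    show "prob1 (B (r * N + k) \<inter> post r (Suc k)) = b * \<alpha> ^ (N - Suc k)"
      by (simp only: prob1_B prob1_post)
  qed
  have k': "M - k \<le> M" by simp
  note 1 = split[OF assms(2)] co[OF assms(2)] pe[OF assms(2)] bo[OF assms(2)] pr[OF assms(2)]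
  note 2 = split[OF k'] co[OF k'] pe[OF k'] bo[OF k'] pr[OF k']
  have z: "z \<in> (pre r k \<inter> A (r * N + k)) \<times> (pre r (M - k) \<inter> A (r * N + (M - k)))"
    using assms(1) by (auto simp: good_part_def)
  have sp: "spike r = ((pre r k \<inter> A (r * N + k)) \<inter> (B (r * N + k) \<inter> post r (Suc k))) \<times>
      ((pre r (M - k) \<inter> A (r * N + (M - k))) \<inter> (B (r * N + (M - k)) \<inter> post r (Suc (M - k))))"
    by (simp only: spike_def 1(1)[symmetric] 2(1)[symmetric])
  have "measure lebesgue (R \<inter> spike r) / measure lebesgue R =
      (b * \<alpha> ^ (N - Suc k)) * (b * \<alpha> ^ (N - Suc (M - k)))"
    unfolding R_def sp measure_dyadic_rect_Int_product[OF assms(3) 1(2,3,4) 2(2,3,4)]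
    by (simp only: z if_True 1(5) 2(5))
  also have "\<dots> = b ^ 2 * \<alpha> ^ ((N - Suc k) + (N - Suc (M - k)))"
    by (simp add: power_add power2_eq_square)
  also have "(N - Suc k) + (N - Suc (M - k)) = M + 2"
    using assms(2) by (simp add: N_def)
  finally show ?thesis .
qed

end

section \<open>Independent copies of the spike\<close>

context digit_scales
begin

text \<open>
  The last position before the windows of block \<open>r\<close>.
\<close>
definition edge :: "nat \<Rightarrow> nat" where "edge r = d (r * N) - u"

lemma edge_mono: "r \<le> s \<Longrightarrow> edge r \<le> edge s"
  unfolding edge_def by (intro diff_le_mono d_mono) simp

lemma coarse_in_block:
  assumes "k < N"
  shows "coarse (edge (Suc r)) (pre r k)" "coarse (edge (Suc r)) (pre r (Suc k))"
    "coarse (edge (Suc r)) (A (r * N + k))" "coarse (edge (Suc r)) (B (r * N + k))"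
proof -
  have le: "d (r * N + k) + v \<le> edge (Suc r)"
    unfolding edge_def by (rule separated_lt) (use assms in simp)
  have pre: "coarse (edge (Suc r)) (pre r l)" if "l \<le> N" for l
    unfolding edge_def by (rule coarse_pre) (rule separated_lt, use that in simp)
  show "coarse (edge (Suc r)) (pre r k)" "coarse (edge (Suc r)) (pre r (Suc k))"
    using assms by (auto intro: pre)
  show "coarse (edge (Suc r)) (A (r * N + k))"
    by (rule coarse_mono[OF A_digits(1)]) (use le in simp)
  show "coarse (edge (Suc r)) (B (r * N + k))"
    by (rule coarse_mono[OF B_digits(1) le])
qed

lemma periodic_in_block:
  "periodic (edge r) (pre r k)"
  "periodic (edge r) (A (r * N + k))" "periodic (edge r) (B (r * N + k))"
proof -
  have le: "d (r * N) \<le> d (r * N + k)" by (rule d_mono) simp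
  show "periodic (edge r) (pre r k)" unfolding edge_def by (rule periodic_pre)
  show "periodic (edge r) (A (r * N + k))"
    by (rule periodic_mono[OF A_digits(2)]) (use le in \<open>simp add: edge_def\<close>)
  show "periodic (edge r) (B (r * N + k))"
    by (rule periodic_mono[OF B_digits(2)]) (use le in \<open>simp add: edge_def\<close>)
qed

lemma coarse2_good: "coarse2 (edge (Suc r)) (edge (Suc r)) (good r)"
  unfolding good_def good_part_def
  by (intro coarse2_UN coarse2_Times coarse_Int coarse_Diff coarse_in_block) (auto simp: N_def)

lemma periodic2_good: "periodic2 (edge r) (edge r) (good r)"
  unfolding good_def good_part_def
  by (intro periodic2_UN periodic2_Times periodic_Int periodic_Diff periodic_in_block)

lemma coarse2_spike: "coarse2 (edge (Suc r)) (edge (Suc r)) (spike r)"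
  unfolding spike_def
  using coarse_in_block(2)[of "M + 1" r] by (intro coarse2_Times) (simp_all add: N_def)

lemma coarse2_bad: "coarse2 (edge (Suc r)) (edge (Suc r)) (bad r)"
  unfolding bad_def by (intro coarse2_UN coarse2_Times coarse_in_block) (auto simp: N_def)

lemmas good_borel = coarse2_borel[OF coarse2_good]
lemmas spike_borel = coarse2_borel[OF coarse2_spike]
lemmas bad_borel = coarse2_borel[OF coarse2_bad]

lemma prob2_spike: "prob2 (spike r) = \<alpha> ^ (2 * N)"
  unfolding spike_def
  by (subst prob2_Times) (simp_all add: pre_borel prob1_pre power_add[symmetric] mult_2)

lemma spike_subset_bad: "spike r \<subseteq> bad r"
proof -
  have "pre r N \<times> pre r N \<subseteq> pre r 0 \<times> pre r (M + 1 - 0)"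
    by (intro Sigma_mono pre_antimono) (auto simp: N_def)
  then show ?thesis
    unfolding spike_def bad_def by blast
qed

lemma prob2_bad_le: "prob2 (bad r) \<le> (M + 2) * \<alpha> ^ (M + 1)"
proof -
  have "prob2 (bad r) \<le> (\<Sum>k\<in>{..M + 1}. prob2 (pre r k \<times> pre r (M + 1 - k)))"
    unfolding bad_def by (intro prob2_UN_le) (auto intro!: Times_borel pre_borel)
  also have "\<dots> = (\<Sum>k\<in>{..M + 1}. \<alpha> ^ (M + 1))"
    by (intro sum.cong refl) (auto simp: prob2_Times pre_borel prob1_pre power_add[symmetric])
  finally show ?thesis by (simp add: algebra_simps)
qed

text \<open>
  The measure of the good set of one copy.
\<close>
definition hit :: real where "hit = (M + 1) * (a * (1 - b) * a * \<alpha> ^ M)"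

lemma prob2_good: "prob2 (good r) = hit"
proof -
  have part: "prob2 (good_part r k) = a * (1 - b) * a * \<alpha> ^ M" if "k \<le> M" for k
  proof -
    have "prob1 (pre r k \<inter> (A (r * N + k) - B (r * N + k))) = \<alpha> ^ k * (a * (1 - b))"
      by (subst prob1_indep[OF coarse_pre'])
         (auto simp: prob1_pre prob1_A_minus_B intro!: sets.Diff A_borel B_borel periodic_Diff A_digits
           periodic_mono[OF B_digits(2)])
    moreover have "prob1 (pre r (M - k) \<inter> A (r * N + (M - k))) = \<alpha> ^ (M - k) * a"
      by (subst prob1_indep[OF coarse_pre' A_digits(2) A_borel]) (simp add: prob1_pre prob1_A)
    ultimately have "prob2 (good_part r k) = (\<alpha> ^ k * (a * (1 - b))) * (\<alpha> ^ (M - k) * a)"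
      unfolding good_part_def by (subst prob2_Times) (auto intro!: sets.Int sets.Diff A_borel B_borel pre_borel)
    also have "\<dots> = a * (1 - b) * a * \<alpha> ^ (k + (M - k))"
      unfolding power_add by simp
    finally show ?thesis using that by simp
  qed
  have disj: "good_part r k \<inter> good_part r l = {}" if "k < l" for k l
  proof -
    have "pre r l \<subseteq> X (r * N + k)"
      unfolding pre_def using that by (intro INT_lower) auto
    then show ?thesis
      unfolding good_part_def X_def by blast
  qed
  have "prob2 (good r) = (\<Sum>k\<in>{..M}. prob2 (good_part r k))"
    unfolding good_def
  proof (rule prob2_UN_disjoint)
    show "good_part r k \<in> sets borel" for k
      unfolding good_part_def by (intro Times_borel sets.Int sets.Diff A_borel B_borel pre_borel)
    show "pairwise (\<lambda>k l. good_part r k \<inter> good_part r l = {}) {..M}"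
      using disj by (auto simp: pairwise_def) (metis Int_commute nat_neq_iff empty_iff IntI)
  qed simp
  also have "\<dots> = (\<Sum>k\<in>{..M}. a * (1 - b) * a * \<alpha> ^ M)"
    by (intro sum.cong refl part) simp
  finally show ?thesis by (simp add: hit_def)
qed

text \<open>
  The third estimate compares the good set with \<open>M + 1\<close> rectangles of measure
  \<open>a ^ 2 * \<alpha> ^ M\<close>; the loss \<open>1 - b\<close> from making them disjoint is at most a factor \<open>2\<close>.
\<close>
lemma hit_bounds: "0 < hit" "hit \<le> 1" "(M + 1) * (a ^ 2 * \<alpha> ^ M) \<le> 2 * hit"
proof -
  show "0 < hit"
    using a_bounds b_bounds \<alpha>_bounds by (simp add: hit_def)
  have "prob2 (good 0) \<le> measure lebesgue unit_square"
    unfolding prob2_def by (intro measure_mono_fmeasurable unit_square_lmeasurable sets.Int)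
      (auto intro!: lborelD good_borel)
  then show "hit \<le> 1"
    by (simp only: prob2_good measure_unit_square)
  have "a ^ 2 * \<alpha> ^ M * 1 \<le> a ^ 2 * \<alpha> ^ M * (2 * (1 - b))"
    using a_bounds b_bounds \<alpha>_bounds by (intro mult_left_mono) auto
  then have "(M + 1) * (a ^ 2 * \<alpha> ^ M) \<le> (M + 1) * (a ^ 2 * \<alpha> ^ M * (2 * (1 - b)))"
    by (intro mult_left_mono) auto
  also have "(M + 1) * (a ^ 2 * \<alpha> ^ M * (2 * (1 - b))) = 2 * hit"
    by (simp add: hit_def power2_eq_square algebra_simps)
  finally show "(M + 1) * (a ^ 2 * \<alpha> ^ M) \<le> 2 * hit" .
qed

text \<open>
  The good sets of different copies use different blocks of digits and are therefore independent.
\<close>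
lemma prob2_no_good:
  "coarse2 (edge K) (edge K) (\<Inter>r\<in>{..<K}. - good r)" (is ?co)
  "prob2 (\<Inter>r\<in>{..<K}. - good r) = (1 - hit) ^ K" (is ?pr)
proof -
  have "?co \<and> ?pr"
  proof (induction K)
    case 0
    then show ?case by (simp add: prob2_UNIV coarse2_def)
  next
    case (Suc K)
    have eq: "(\<Inter>r\<in>{..<Suc K}. - good r) = (\<Inter>r\<in>{..<K}. - good r) \<inter> - good K"
      by (auto simp: lessThan_Suc)
    have "coarse2 (edge (Suc K)) (edge (Suc K)) (\<Inter>r\<in>{..<Suc K}. - good r)"
    proof (rule coarse2_INT)
      fix r assume "r \<in> {..<Suc K}"
      then have "edge (Suc r) \<le> edge (Suc K)" by (intro edge_mono) simp
      then show "coarse2 (edge (Suc K)) (edge (Suc K)) (- good r)"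
        by (intro coarse2_Compl coarse2_mono[OF coarse2_good])
    qed
    moreover have "prob2 ((\<Inter>r\<in>{..<K}. - good r) \<inter> - good K) =
        prob2 (\<Inter>r\<in>{..<K}. - good r) * prob2 (- good K)"
      by (rule prob2_indep[OF conjunct1[OF Suc.IH] periodic2_Compl[OF periodic2_good] borel_comp[OF good_borel]])
    ultimately show ?case
      using Suc.IH by (simp only: eq prob2_Compl[OF good_borel] prob2_good power_Suc) simp
  qed
  then show ?co ?pr by auto
qed

text \<open>
  The factor that makes the average of the spike equal to \<open>h\<close> on the rectangles of
  \<open>good_part\<close>.
\<close>
definition weight :: "real \<Rightarrow> real" where
  "weight h = h * a ^ 2 * \<alpha> ^ M / \<alpha> ^ (2 * N)"

definition spikes :: "real \<Rightarrow> nat \<Rightarrow> real \<times> real \<Rightarrow> real" where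
  "spikes h K z = weight h * (\<Sum>r<K. indicator (unit_square \<inter> spike r) z)"

lemma weight_nonneg: "0 \<le> h \<Longrightarrow> 0 \<le> weight h"
  using a_bounds \<alpha>_bounds by (simp add: weight_def)

lemma weight_mult: "weight h * \<alpha> ^ (2 * N) = h * a ^ 2 * \<alpha> ^ M"
  "weight h * \<alpha> ^ (M + 4) = h * a ^ 2"
  "weight h * (b ^ 2 * \<alpha> ^ (M + 2)) = h"
proof -
  have cancel: "q \<noteq> 0 \<Longrightarrow> x / q * q = x"
    "q \<noteq> 0 \<Longrightarrow> p \<noteq> 0 \<Longrightarrow> x * p / (p * q) * q = x"
    "q \<noteq> 0 \<Longrightarrow> p \<noteq> 0 \<Longrightarrow> x * y * p / (c * (p * q)) * (z * q) = x * (y * z / c)" for x y z p q c :: real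
    by simp_all
  have nz: "\<alpha> \<noteq> 0" "a \<noteq> 0" "b \<noteq> 0" using \<alpha>_bounds a_bounds b_bounds by auto
  then have "\<alpha> ^ (2 * N) \<noteq> 0" by simp
  then show "weight h * \<alpha> ^ (2 * N) = h * a ^ 2 * \<alpha> ^ M"
    unfolding weight_def by (rule cancel(1))
  have "2 * N = M + (M + 4)" by (simp add: N_def)
  then have w: "weight h = h * a ^ 2 * \<alpha> ^ M / (\<alpha> ^ M * \<alpha> ^ (M + 4))"
    by (simp only: weight_def power_add)
  have "\<alpha> ^ (M + 4) \<noteq> 0" "\<alpha> ^ M \<noteq> 0" using nz by auto
  then show "weight h * \<alpha> ^ (M + 4) = h * a ^ 2"
    unfolding w by (rule cancel(2))
  have "2 * N = 2 + (M + (M + 2))" by (simp add: N_def)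
  then have w: "weight h = h * a ^ 2 * \<alpha> ^ M / (\<alpha> ^ 2 * (\<alpha> ^ M * \<alpha> ^ (M + 2)))"
    by (simp only: weight_def power_add)
  have "\<alpha> ^ (M + 2) \<noteq> 0" "\<alpha> ^ M \<noteq> 0" using nz by auto
  then have "weight h * (b ^ 2 * \<alpha> ^ (M + 2)) = h * (a ^ 2 * b ^ 2 / \<alpha> ^ 2)"
    unfolding w by (rule cancel(3))
  also have "a ^ 2 * b ^ 2 / \<alpha> ^ 2 = 1"
    using nz(2,3) by (simp add: \<alpha>_def power_mult_distrib)
  finally show "weight h * (b ^ 2 * \<alpha> ^ (M + 2)) = h" by simp
qed

lemma spike_indicator_integral:
  assumes "S \<in> sets borel"
  shows "integrable lebesgue (indicator (unit_square \<inter> S) :: _ \<Rightarrow> real)"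
    "(LINT z|lebesgue. indicator (unit_square \<inter> S) z) = prob2 S"
  using prob2_lmeasurable[OF assms]
  by (auto simp: prob2_def lmeasurable_iff_integrable integrable_indicator_iff fmeasurable_def)

lemma spikes_nonneg: "0 \<le> h \<Longrightarrow> 0 \<le> spikes h K z"
  unfolding spikes_def by (intro mult_nonneg_nonneg weight_nonneg sum_nonneg) auto

lemma integrable_spikes: "integrable lebesgue (spikes h K)"
  unfolding spikes_def
  by (intro integrable_mult_right Bochner_Integration.integrable_sum spike_indicator_integral(1) spike_borel)

lemma integral_spikes: "(LINT z|lebesgue. spikes h K z) = K * (h * a ^ 2 * \<alpha> ^ M)"
proof -
  have "(LINT z|lebesgue. spikes h K z) = weight h * (\<Sum>r<K. prob2 (spike r))"
    unfolding spikes_def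
    by (simp add: prob2_def spike_indicator_integral(1)[OF spike_borel] Bochner_Integration.integral_sum)
  also have "\<dots> = K * (weight h * \<alpha> ^ (2 * N))"
    by (simp add: prob2_spike)
  finally show ?thesis by (simp only: weight_mult)
qed

lemma dyadic_average_spikes:
  assumes "i \<in> {1..2 ^ n}" "j \<in> {1..2 ^ m}"
  shows "dyadic_average (spikes h K) n m i j =
    weight h * (\<Sum>r<K. measure lebesgue (dyadic_rect n m i j \<inter> spike r) / measure lebesgue (dyadic_rect n m i j))"
proof -
  let ?R = "dyadic_rect n m i j"
  have sub: "unit_square \<inter> (?R \<inter> spike r) = ?R \<inter> spike r" for r
    using dyadic_rect_subset_unit_square[OF assms] by auto
  have pt: "indicator ?R w *\<^sub>R spikes h K w = weight h * (\<Sum>r<K. indicator (unit_square \<inter> (?R \<inter> spike r)) w)" for w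
  proof (cases "w \<in> ?R")
    case True
    then have "indicator (unit_square \<inter> spike r) w = (indicator (unit_square \<inter> (?R \<inter> spike r)) w :: real)" for r
      by (simp add: indicator_def)
    then show ?thesis
      using True by (simp only: spikes_def indicator_simps(1) scaleR_one)
  next
    case False
    then have "indicator (unit_square \<inter> (?R \<inter> spike r)) w = (0 :: real)" for r
      by simp
    moreover have "indicator ?R w = (0 :: real)"
      using False by simp
    ultimately show ?thesis
      by (simp only: scaleR_zero_left sum.neutral_const mult_zero_right)
  qed
  have "(LINT w:?R|lebesgue. spikes h K w) =
      (LINT w|lebesgue. weight h * (\<Sum>r<K. indicator (unit_square \<inter> (?R \<inter> spike r)) w))"
    unfolding set_lebesgue_integral_def pt ..
  also have "\<dots> = weight h * (\<Sum>r<K. prob2 (?R \<inter> spike r))"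
    by (simp add: prob2_def spike_indicator_integral(1)[OF sets.Int[OF dyadic_rect_borel spike_borel]]
        Bochner_Integration.integral_sum)
  also have "(\<Sum>r<K. prob2 (?R \<inter> spike r)) = (\<Sum>r<K. measure lebesgue (?R \<inter> spike r))"
    unfolding prob2_def sub ..
  finally show ?thesis
    unfolding dyadic_average_def by (simp only: sum_divide_distrib[symmetric] times_divide_eq_right)
qed

lemma dyadic_average_spikes_le:
  assumes "0 \<le> h" "n \<in> C" "m \<in> C" "i \<in> {1..2 ^ n}" "j \<in> {1..2 ^ m}" "z \<in> dyadic_rect n m i j"
    "z \<notin> (\<Union>r<K. bad r)"
  shows "dyadic_average (spikes h K) n m i j \<le> K * (h * a ^ 2 * \<alpha> ^ M) + h * a ^ 2"
proof -
  have "dyadic_average (spikes h K) n m i j \<le> weight h * (K * \<alpha> ^ (2 * N) + \<alpha> ^ (M + 4))"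
    unfolding dyadic_average_spikes[OF assms(4,5)]
    by (intro mult_left_mono spikes_average_at_C_levels[OF assms(2,3,6)] weight_nonneg assms(1))
       (use assms(7) in auto)
  also have "\<dots> = K * (weight h * \<alpha> ^ (2 * N)) + weight h * \<alpha> ^ (M + 4)"
    by (simp only: distrib_left mult.left_commute)
  finally show ?thesis by (simp only: weight_mult)
qed

lemma dyadic_average_spikes_ge:
  assumes "0 \<le> h" "z \<in> unit_square" "z \<in> (\<Union>r<K. good r)"
  obtains s t i j where "i \<in> {1..2 ^ d s}" "j \<in> {1..2 ^ d t}" "z \<in> dyadic_rect (d s) (d t) i j"
    "h \<le> dyadic_average (spikes h K) (d s) (d t) i j"
proof -
  obtain r k where r: "r < K" "k \<le> M" "z \<in> good_part r k"
    using assms(3) by (auto simp: good_def)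
  let ?s = "r * N + k" and ?t = "r * N + (M - k)"
  obtain i j where ij: "i \<in> {1..2 ^ d ?s}" "j \<in> {1..2 ^ d ?t}" "z \<in> dyadic_rect (d ?s) (d ?t) i j"
    using unit_square_dyadic_cover[OF assms(2)] by blast
  let ?R = "dyadic_rect (d ?s) (d ?t) i j"
  have "h = weight h * (measure lebesgue (?R \<inter> spike r) / measure lebesgue ?R)"
    unfolding spike_average_on_good[OF r(3,2) ij(3)] weight_mult ..
  also have "\<dots> \<le> weight h * (\<Sum>r<K. measure lebesgue (?R \<inter> spike r) / measure lebesgue ?R)"
    by (intro mult_left_mono weight_nonneg assms(1) member_le_sum) (use r(1) in auto)
  also have "\<dots> = dyadic_average (spikes h K) (d ?s) (d ?t) i j"
    by (rule dyadic_average_spikes[OF ij(1,2), symmetric])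
  finally show ?thesis
    using that[OF ij] by blast
qed

lemma spikes_eq_0:
  assumes "z \<notin> unit_square \<inter> (\<Union>r<K. bad r)"
  shows "spikes h K z = 0"
proof -
  have "indicator (unit_square \<inter> spike r) z = (0 :: real)" if "r < K" for r
  proof -
    have "z \<notin> unit_square \<inter> spike r"
      using assms spike_subset_bad[of r] that by blast
    then show ?thesis by simp
  qed
  then show ?thesis by (simp add: spikes_def)
qed

lemma spikes_locally_constant:
  assumes "edge K \<le> n" "edge K \<le> m" "i \<in> {1..2 ^ n}" "j \<in> {1..2 ^ m}"
    and "z \<in> dyadic_rect n m i j" "z' \<in> dyadic_rect n m i j"
  shows "spikes h K z = spikes h K z'"
proof -
  have "indicator (unit_square \<inter> spike r) z = (indicator (unit_square \<inter> spike r) z' :: real)" if "r < K" for r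
  proof -
    have "edge (Suc r) \<le> edge K" using that by (intro edge_mono) simp
    then have "coarse2 n m (spike r)"
      using assms(1,2) by (intro coarse2_mono[OF coarse2_spike]) auto
    then have "z \<in> spike r \<longleftrightarrow> z' \<in> spike r"
      by (rule coarse2D) (use assms(5,6) in \<open>simp_all add: mem_dyadic_rect_iff\<close>)
    moreover have "z \<in> unit_square" "z' \<in> unit_square"
      using dyadic_rect_subset_unit_square[OF assms(3,4)] assms(5,6) by auto
    ultimately show ?thesis by (simp add: indicator_def)
  qed
  then show ?thesis by (simp add: spikes_def)
qed

lemma prob2_all_bad_le: "prob2 (\<Union>r<K. bad r) \<le> K * ((M + 2) * \<alpha> ^ (M + 1))"
proof -
  have "prob2 (\<Union>r<K. bad r) \<le> (\<Sum>r<K. prob2 (bad r))"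
    by (intro prob2_UN_le bad_borel) auto
  also have "\<dots> \<le> (\<Sum>r<K. (M + 2) * \<alpha> ^ (M + 1))"
    by (intro sum_mono prob2_bad_le)
  finally show ?thesis by simp
qed

end

section \<open>One stage of the construction\<close>

text \<open>
  About \<open>h / hit\<close> copies leave at most \<open>exp (- h)\<close> of the square uncovered by good sets. As
  \<open>hit\<close> is of order \<open>(M + 1) a ^ 2 \<alpha> ^ M\<close>, the total integral is of order
  \<open>h ^ 2 / (M + 1)\<close> and the bad sets have total measure of order \<open>h b / a\<close>. The choice of
  \<open>u\<close>, \<open>v\<close> and \<open>M\<close> makes \<open>h a ^ 2\<close>, \<open>h b / a\<close> and \<open>h ^ 2 / (M + 1)\<close>
  smaller than \<open>2 ^ (- k)\<close>, with room for the constants.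
\<close>
lemma (in digit_scales) number_of_copies:
  fixes k :: nat
  defines "h \<equiv> real (k + 1)"
  assumes "u = k + 2" "v = 3 * k + 5" "M = 8 * (k + 1) ^ 2 * 2 ^ k"
  shows "\<exists>K::nat. K * (h * a ^ 2 * \<alpha> ^ M) + h * a ^ 2 \<le> 1 / 2 ^ k \<and>
    K * ((M + 2) * \<alpha> ^ (M + 1)) \<le> 1 / 2 ^ k \<and> (1 - hit) ^ K \<le> 1 / 2 ^ k"
proof -
  define K where "K = nat \<lceil>h / hit\<rceil>"
  define q where "q = a ^ 2 * \<alpha> ^ M"
  have h: "1 \<le> h" "0 < h" "h \<le> 2 ^ k"
  proof -
    have "k + 1 \<le> 2 ^ k" by (induction k) auto
    then show "h \<le> 2 ^ k" unfolding h_def by (metis of_nat_le_iff of_nat_numeral of_nat_power)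
  qed (auto simp: h_def)
  have q: "0 < q" using a_bounds \<alpha>_bounds by (simp add: q_def)
  have K: "h / hit \<le> K" "K \<le> 2 * h / hit"
  proof -
    show "h / hit \<le> K" unfolding K_def by linarith
    have "1 \<le> h / hit" using h hit_bounds(1,2) by (simp add: field_simps)
    moreover have "K \<le> h / hit + 1" unfolding K_def using h hit_bounds by (simp add: of_nat_ceiling)
    ultimately show "K \<le> 2 * h / hit" by simp
  qed
  have Kq: "K * q * (M + 1) \<le> 4 * h"
  proof -
    have "K * q * (M + 1) = K * ((M + 1) * q)" by simp
    also have "\<dots> \<le> (2 * h / hit) * (2 * hit)"
    proof (rule mult_mono[OF K(2)])
      show "(M + 1) * q \<le> 2 * hit" using hit_bounds(3) by (simp only: q_def)
      show "0 \<le> 2 * h / hit" using h hit_bounds(1) by simp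
      show "0 \<le> (M + 1) * q" using q by simp
    qed
    also have "\<dots> = 4 * h" using hit_bounds(1) by simp
    finally show ?thesis .
  qed
  have M1: "8 * h ^ 2 * 2 ^ k \<le> M + 1"
    using assms(4) by (simp add: h_def add.commute)
  have "K * (h * a ^ 2 * \<alpha> ^ M) \<le> 1 / 2 / 2 ^ k"
  proof -
    have "(K * q * h) * (8 * h ^ 2 * 2 ^ k) \<le> (K * q * h) * (M + 1)"
      using M1 q h by (intro mult_left_mono) auto
    also have "\<dots> = (K * q * (M + 1)) * h" by simp
    also have "\<dots> \<le> (4 * h) * h" using Kq h by (intro mult_right_mono) auto
    finally have "(K * q * h) * (2 * 2 ^ k) * (4 * h ^ 2) \<le> 1 * (4 * h ^ 2)"
      by (simp add: power2_eq_square mult_ac)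
    then have "(K * q * h) * (2 * 2 ^ k) \<le> 1"
      using h by (simp only: mult_le_cancel_right) auto
    then show ?thesis by (simp add: q_def field_simps)
  qed
  moreover have "h * a ^ 2 \<le> 1 / 2 / 2 ^ k"
  proof -
    have "a ^ 2 = 1 / (16 * (2 ^ k * 2 ^ k))"
      unfolding a_def unfolding assms(2) by (simp add: power2_eq_square power_add)
    then have "h * a ^ 2 \<le> 2 ^ k * (1 / (16 * (2 ^ k * 2 ^ k)))"
      using h by (simp only:) (intro mult_right_mono; simp)
    also have "\<dots> \<le> 1 / 2 / 2 ^ k" by (simp add: field_simps)
    finally show ?thesis .
  qed
  moreover have "K * ((M + 2) * \<alpha> ^ (M + 1)) \<le> 1 / 2 ^ k"
  proof -
    have "a * \<alpha> ^ (M + 1) = b * q" by (simp add: q_def \<alpha>_def power2_eq_square)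
    moreover have "a = 8 * 2 ^ k * 2 ^ k * b"
    proof -
      have "3 * k + 5 = (k + 2) + (k + (k + 3))" by simp
      then show ?thesis
        unfolding a_def b_def unfolding assms(2,3) by (simp only: power_add) simp
    qed
    ultimately have "b * q = 8 * 2 ^ k * 2 ^ k * b * \<alpha> ^ (M + 1)" by metis
    then have "b * q = b * (8 * 2 ^ k * 2 ^ k * \<alpha> ^ (M + 1))" by (simp only: mult_ac)
    then have q8: "q = 8 * 2 ^ k * 2 ^ k * \<alpha> ^ (M + 1)"
      using b_bounds(1) by (simp only: mult_cancel_left) auto
    have "8 * 2 ^ k * 2 ^ k * (K * ((M + 2) * \<alpha> ^ (M + 1))) = K * q * (M + 2)"
      unfolding q8 by simp
    also have "\<dots> \<le> K * q * (2 * (M + 1))"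
      using q by (intro mult_left_mono) auto
    also have "\<dots> \<le> 8 * h" using Kq by (simp add: algebra_simps)
    also have "\<dots> \<le> 8 * 2 ^ k" using h by simp
    finally have "(8 * 2 ^ k) * (2 ^ k * (K * ((M + 2) * \<alpha> ^ (M + 1)))) \<le> (8 * 2 ^ k) * 1"
      by (simp add: mult.assoc)
    then have "2 ^ k * (K * ((M + 2) * \<alpha> ^ (M + 1))) \<le> 1"
      by (simp only: mult_le_cancel_left) auto
    then show ?thesis by (simp add: field_simps)
  qed
  moreover have "(1 - hit) ^ K \<le> 1 / 2 ^ k"
  proof -
    have "(1 - hit) ^ K \<le> exp (- hit) ^ K"
      using hit_bounds exp_ge_add_one_self[of "- hit"] by (intro power_mono) auto
    also have "\<dots> = exp (- (hit * K))" by (simp add: exp_of_nat_mult[symmetric] mult.commute)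
    also have "\<dots> \<le> exp (- h)"
      using K(1) hit_bounds(1) by (simp add: field_simps)
    also have "\<dots> = 1 / exp 1 ^ (k + 1)"
      using exp_of_nat_mult[of "k + 1" "1::real"] unfolding h_def
      by (simp only: exp_minus mult_1_right inverse_eq_divide)
    also have "\<dots> \<le> 1 / 2 ^ k"
    proof (rule divide_left_mono)
      have "(2::real) \<le> exp 1" using exp_ge_add_one_self[of 1] by simp
      then have "(2::real) ^ (k + 1) \<le> exp 1 ^ (k + 1)" by (intro power_mono) auto
      moreover have "(2::real) ^ k \<le> 2 ^ (k + 1)" by simp
      ultimately show "(2::real) ^ k \<le> exp 1 ^ (k + 1)" by linarith
    qed auto
    finally show ?thesis .
  qed
  ultimately show ?thesis
    by (intro exI[of _ K]) auto
qed

text \<open>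
  Adding \<open>q\<close> and an element of \<open>C\<close> to the required distance forces the element found to be at
  least \<open>q\<close>.
\<close>
lemma far_elements:
  assumes "C \<noteq> {}" "(SUP n\<in>D. enat (dist_to_set n C)) = \<infinity>"
  shows "\<exists>e\<in>D. q \<le> e \<and> (\<forall>c\<in>C. c + l \<le> e \<or> e + l \<le> c)"
proof -
  obtain c0 where "c0 \<in> C" using assms(1) by blast
  have "enat (q + c0 + l) < (SUP n\<in>D. enat (dist_to_set n C))"
    by (simp add: assms(2))
  then obtain e where e: "e \<in> D" "q + c0 + l < dist_to_set e C"
    by (auto simp: less_SUP_iff)
  have far: "q + c0 + l < nat \<bar>int e - int c\<bar>" if "c \<in> C" for c
  proof -
    have "dist_to_set e C \<le> nat \<bar>int e - int c\<bar>"
      unfolding dist_to_set_def by (rule cINF_lower) (use that in auto)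
    with e(2) show ?thesis by linarith
  qed
  have "q \<le> e" using far[OF \<open>c0 \<in> C\<close>] by linarith
  moreover have "c + l \<le> e \<or> e + l \<le> c" if "c \<in> C" for c
    using far[OF that] by linarith
  ultimately show ?thesis using e(1) by blast
qed

lemma digit_scales_exist:
  assumes "C \<noteq> {}" "(SUP n\<in>D. enat (dist_to_set n C)) = \<infinity>" "0 < v"
  obtains d where "digit_scales C d u v" "range d \<subseteq> D" "\<And>t. q \<le> d t"
proof -
  let ?P = "\<lambda>e. e \<in> D \<and> q + u \<le> e \<and> (\<forall>c\<in>C. c + (u + v) \<le> e \<or> e + (u + v) \<le> c)"
  have "\<exists>e. ?P e \<and> s \<le> e" for s
    using far_elements[OF assms(1,2), of "q + u + s" "u + v"] by (metis add_leD1 add_leD2 add.commute)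
  then have "\<exists>d. \<forall>t. ?P (d t) \<and> d t + v + u \<le> d (Suc t)"
    by (intro dependent_nat_choice) (auto, metis)
  then obtain d where d: "\<And>t. ?P (d t)" "\<And>t. d t + v + u \<le> d (Suc t)"
    by blast
  have "digit_scales C d u v"
  proof
    show "u \<le> d 0" using d(1)[of 0] by linarith
    show "n + u \<le> d t \<or> d t + v \<le> n" if "n \<in> C" for n t
      using d(1)[of t] that by (metis add.assoc add.commute add_leD1)
  qed (use d assms(3) in auto)
  then show ?thesis
    using that[of d] d(1) by (meson add_leD1 image_subset_iff)
qed

text \<open>
  A nonnegative function of small integral whose \<open>C\<close>-averages are small outside \<open>Bad\<close> and which
  has a large \<open>D\<close>-average of fine level at every point of \<open>Good\<close>. It is constant on dyadic
  rectangles of levels at least \<open>L\<close>, so a finite sum of such functions converges along every basis.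
\<close>
definition stage_function ::
  "nat set \<Rightarrow> nat set \<Rightarrow> nat \<Rightarrow>
    (real \<times> real \<Rightarrow> real) \<Rightarrow> (real \<times> real) set \<Rightarrow> (real \<times> real) set \<Rightarrow> nat \<Rightarrow> bool" where
  "stage_function C D k g Bad Good L \<longleftrightarrow>
    (\<forall>z. 0 \<le> g z) \<and> integrable lebesgue g \<and> (LINT z|lebesgue. g z) \<le> 1 / 2 ^ k \<and>
    Bad \<in> sets borel \<and> prob2 Bad \<le> 1 / 2 ^ k \<and> Good \<in> sets borel \<and> prob2 (- Good) \<le> 1 / 2 ^ k \<and>
    (\<forall>z. z \<notin> unit_square \<inter> Bad \<longrightarrow> g z = 0) \<and>
    (\<forall>n\<in>C. \<forall>m\<in>C. \<forall>i\<in>{1..2 ^ n}. \<forall>j\<in>{1..2 ^ m}. \<forall>z\<in>dyadic_rect n m i j. z \<notin> Bad \<longrightarrow>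
       dyadic_average g n m i j \<le> 1 / 2 ^ k) \<and>
    (\<forall>z\<in>unit_square \<inter> Good. \<exists>n\<in>D. \<exists>m\<in>D. \<exists>i\<in>{1..2 ^ n}. \<exists>j\<in>{1..2 ^ m}.
       k \<le> n \<and> k \<le> m \<and> z \<in> dyadic_rect n m i j \<and> k \<le> dyadic_average g n m i j) \<and>
    (\<forall>n m. \<forall>i\<in>{1..2 ^ n}. \<forall>j\<in>{1..2 ^ m}. L \<le> n \<longrightarrow> L \<le> m \<longrightarrow>
       (\<forall>z\<in>dyadic_rect n m i j. \<forall>z'\<in>dyadic_rect n m i j. g z = g z'))"

lemma stage_function_exists:
  assumes "C \<noteq> {}" "(SUP n\<in>D. enat (dist_to_set n C)) = \<infinity>"
  shows "\<exists>g Bad Good L. stage_function C D k g Bad Good L"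
proof -
  define u where "u = k + 2"
  define v where "v = 3 * k + 5"
  define M where "M = 8 * (k + 1) ^ 2 * 2 ^ k"
  define h where "h = real (k + 1)"
  obtain d where d: "digit_scales C d u v" "range d \<subseteq> D" "\<And>t. k \<le> d t"
    using digit_scales_exist[OF assms, of v u k] by (auto simp: v_def)
  interpret digit_scales C d u v M by (rule d(1))
  obtain K where K: "K * (h * a ^ 2 * \<alpha> ^ M) + h * a ^ 2 \<le> 1 / 2 ^ k"
    "K * ((M + 2) * \<alpha> ^ (M + 1)) \<le> 1 / 2 ^ k" "(1 - hit) ^ K \<le> 1 / 2 ^ k"
    using number_of_copies[OF u_def v_def M_def] unfolding h_def by blast
  have h: "0 \<le> h" "k \<le> h" by (simp_all add: h_def)
  show ?thesis
    unfolding stage_function_def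
  proof (rule exI[of _ "spikes h K"], rule exI[of _ "\<Union>r<K. bad r"], rule exI[of _ "\<Union>r<K. good r"],
      rule exI[of _ "edge K"], intro conjI allI ballI impI)
    have "0 \<le> h * a ^ 2" using h by simp
    then show "(LINT z|lebesgue. spikes h K z) \<le> 1 / 2 ^ k"
      unfolding integral_spikes using K(1) by linarith
    show "prob2 (\<Union>r<K. bad r) \<le> 1 / 2 ^ k"
      using prob2_all_bad_le[of K] K(2) by linarith
    show "prob2 (- (\<Union>r<K. good r)) \<le> 1 / 2 ^ k"
      using prob2_no_good(2)[of K] K(3) by (simp add: Compl_UN)
    show "dyadic_average (spikes h K) n m i j \<le> 1 / 2 ^ k"
      if "n \<in> C" "m \<in> C" "i \<in> {1..2 ^ n}" "j \<in> {1..2 ^ m}" "z \<in> dyadic_rect n m i j" "z \<notin> (\<Union>r<K. bad r)"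
      for n m i j z
      using dyadic_average_spikes_le[OF h(1) that] K(1) by linarith
    show "\<exists>n\<in>D. \<exists>m\<in>D. \<exists>i\<in>{1..2 ^ n}. \<exists>j\<in>{1..2 ^ m}.
       k \<le> n \<and> k \<le> m \<and> z \<in> dyadic_rect n m i j \<and> k \<le> dyadic_average (spikes h K) n m i j"
      if "z \<in> unit_square \<inter> (\<Union>r<K. good r)" for z
    proof -
      have z: "z \<in> unit_square" "z \<in> (\<Union>r<K. good r)" using that by auto
      obtain s t i j where *: "i \<in> {1..2 ^ d s}" "j \<in> {1..2 ^ d t}" "z \<in> dyadic_rect (d s) (d t) i j"
        "h \<le> dyadic_average (spikes h K) (d s) (d t) i j"
        by (rule dyadic_average_spikes_ge[OF h(1) z])
      have "k \<le> dyadic_average (spikes h K) (d s) (d t) i j"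
        using *(4) h(2) by linarith
      moreover have "d s \<in> D" "d t \<in> D" using d(2) by auto
      ultimately show ?thesis
        using *(1,2,3) d(3)[of s] d(3)[of t] by blast
    qed
    show "0 \<le> spikes h K z" for z by (rule spikes_nonneg[OF h(1)])
    show "integrable lebesgue (spikes h K)" by (rule integrable_spikes)
    show "(\<Union>r<K. bad r) \<in> sets borel" "(\<Union>r<K. good r) \<in> sets borel"
      by (intro sets.finite_UN bad_borel good_borel finite_lessThan)+
    show "spikes h K z = 0" if "z \<notin> unit_square \<inter> (\<Union>r<K. bad r)" for z
      using that by (rule spikes_eq_0)
    show "spikes h K z = spikes h K z'"
      if "i \<in> {1..2 ^ n}" "j \<in> {1..2 ^ m}" "edge K \<le> n" "edge K \<le> m"
        "z \<in> dyadic_rect n m i j" "z' \<in> dyadic_rect n m i j" for n m i j z z'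
      by (rule spikes_locally_constant[OF that(3,4,1,2,5,6)])
  qed
qed

section \<open>Summation of the stages\<close>

lemma dyadic_average_const:
  assumes "\<And>w. w \<in> dyadic_rect n m i j \<Longrightarrow> g w = c"
  shows "dyadic_average g n m i j = c"
proof -
  have "(LINT w:dyadic_rect n m i j|lebesgue. g w) = (LINT w:dyadic_rect n m i j|lebesgue. c)"
    using assms by (intro set_lebesgue_integral_cong) (auto intro!: lborelD)
  also have "\<dots> = measure lebesgue (dyadic_rect n m i j) * c"
    using dyadic_rect_lmeasurable[of n m i j]
    by (simp add: set_lebesgue_integral_def fmeasurable_def)
  finally show ?thesis
    unfolding dyadic_average_def using measure_dyadic_rect[of n m i j] by simp
qed

lemma prob2_Un_le:
  assumes "S \<in> sets borel" "T \<in> sets borel"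
  shows "prob2 (S \<union> T) \<le> prob2 S + prob2 T"
  unfolding prob2_def Int_Un_distrib using assms by (intro measure_Un_le) (auto intro!: lborelD)

text \<open>
  Almost every point lies in only finitely many \<open>Bad k\<close> and in almost all \<open>Good k\<close>. Along
  \<open>C\<close> the finitely many early stages have averages equal to their values at fine levels, and the
  averages of the later stages add up to a small geometric tail. Along \<open>D\<close> stage \<open>k\<close> alone
  provides an average of at least \<open>k\<close>, since all terms are nonnegative.
\<close>
lemma exists_divergent_function:
  assumes "infinite C" "(SUP n\<in>D. enat (dist_to_set n C)) = \<infinity>"
  shows "\<exists>f :: real \<times> real \<Rightarrow> real.
            set_integrable lebesgue unit_square f \<and>
            (\<forall>z\<in>unit_square. f z \<ge> 0) \<and>
            (AE z in lebesgue. z \<in> unit_square \<longrightarrow>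
               oscillation (dyadic_basis C) z f = 0 \<and>
               oscillation (dyadic_basis D) z f = \<infinity>)"
proof -
  have "C \<noteq> {}" using assms(1) by auto
  then have "\<forall>k. \<exists>g Bad Good L. stage_function C D k g Bad Good L"
    using stage_function_exists[OF _ assms(2)] by blast
  then obtain g Bad Good L where st: "\<And>k. stage_function C D k (g k) (Bad k) (Good k) (L k)"
    by metis
  have nonneg: "0 \<le> g k z" and integrable: "integrable lebesgue (g k)"
    and small: "(LINT z|lebesgue. g k z) \<le> 1 / 2 ^ k"
    and Bad: "Bad k \<in> sets borel" "prob2 (Bad k) \<le> 1 / 2 ^ k"
    and Good: "Good k \<in> sets borel" "prob2 (- Good k) \<le> 1 / 2 ^ k"
    and vanish: "z \<notin> unit_square \<inter> Bad k \<Longrightarrow> g k z = 0"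
    for k z
    using st[of k, unfolded stage_function_def] by blast+
  have C_average: "dyadic_average (g k) n m i j \<le> 1 / 2 ^ k"
    if "n \<in> C" "m \<in> C" "i \<in> {1..2 ^ n}" "j \<in> {1..2 ^ m}" "z \<in> dyadic_rect n m i j" "z \<notin> Bad k"
    for k n m i j z
    using st[of k, unfolded stage_function_def] that by blast
  have D_average: "\<exists>n\<in>D. \<exists>m\<in>D. \<exists>i\<in>{1..2 ^ n}. \<exists>j\<in>{1..2 ^ m}.
       k \<le> n \<and> k \<le> m \<and> z \<in> dyadic_rect n m i j \<and> k \<le> dyadic_average (g k) n m i j"
    if "z \<in> unit_square" "z \<in> Good k" for k z
    using st[of k, unfolded stage_function_def] that by blast
  have const: "g k z = g k z'"
    if "i \<in> {1..2 ^ n}" "j \<in> {1..2 ^ m}" "L k \<le> n" "L k \<le> m" "z \<in> dyadic_rect n m i j" "z' \<in> dyadic_rect n m i j"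
    for k n m i j z z'
    using st[of k, unfolded stage_function_def] that by blast
  \<comment> \<open>The absolute value matters only on the null set where the series diverges.\<close>
  define f where "f z = \<bar>\<Sum>k. g k z\<bar>" for z
  have f_eq: "f z = (\<Sum>k. g k z)" if "summable (\<lambda>k. g k z)" for z
    unfolding f_def using suminf_nonneg[OF that] nonneg by simp

  have geometric: "summable (\<lambda>k. 1 / 2 ^ k :: real)"
    using summable_geometric[of "1/2::real"] by (simp add: power_divide)
  have "AE z in lebesgue. \<forall>\<^sub>F k in sequentially. z \<in> space lebesgue - unit_square \<inter> (Bad k \<union> - Good k)"
  proof (rule borel_cantelli_AE1)
    show "emeasure lebesgue (unit_square \<inter> (Bad k \<union> - Good k)) < \<infinity>" for k
      using Bad(1) Good(1) prob2_lmeasurable[of "Bad k \<union> - Good k"] by (auto simp: fmeasurable_def)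
    show "unit_square \<inter> (Bad k \<union> - Good k) \<in> sets lebesgue" for k
      using Bad(1) Good(1) prob2_lmeasurable[of "Bad k \<union> - Good k"] by (auto simp: fmeasurable_def)
    show "summable (\<lambda>k. measure lebesgue (unit_square \<inter> (Bad k \<union> - Good k)))"
    proof (rule summable_comparison_test'[where N=0])
      show "summable (\<lambda>k. 2 * (1 / 2 ^ k) :: real)"
        by (rule summable_mult[OF geometric])
      show "norm (measure lebesgue (unit_square \<inter> (Bad k \<union> - Good k))) \<le> 2 * (1 / 2 ^ k)" for k
        using prob2_Un_le[OF Bad(1)[of k] borel_comp[OF Good(1)[of k]]] Bad(2)[of k] Good(2)[of k]
        by (simp add: prob2_def)
    qed
  qed
  then have ultimately_good: "AE z in lebesgue. z \<in> unit_square \<longrightarrow> (\<exists>K. \<forall>k\<ge>K. z \<notin> Bad k \<and> z \<in> Good k)"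
    by eventually_elim (auto simp: eventually_sequentially)

  have summable: "AE z in lebesgue. summable (\<lambda>k. g k z)"
    using ultimately_good
  proof eventually_elim
    case (elim z)
    show ?case
    proof (cases "z \<in> unit_square")
      case True
      then obtain K where "\<And>k. k \<ge> K \<Longrightarrow> z \<notin> Bad k" using elim by blast
      then show ?thesis
        by (intro summable_finite[of "{..<K}"]) (auto intro!: vanish)
    next
      case False
      then have "g k z = 0" for k by (intro vanish) simp
      then show ?thesis by simp
    qed
  qed
  have summable_integrals: "summable (\<lambda>k. LINT z|lebesgue. g k z)"
    by (rule summable_comparison_test'[OF geometric, of 0])
       (use small nonneg in \<open>auto simp: abs_of_nonneg integral_nonneg_AE\<close>)
  have "integrable lebesgue (\<lambda>z. \<Sum>k. g k z)"
    by (rule integrable_suminf) (use integrable summable summable_integrals nonneg in auto)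
  then have f_integrable: "integrable lebesgue f"
    unfolding f_def by (rule integrable_abs)
  then have f_int: "set_integrable lebesgue unit_square f"
    unfolding set_integrable_def by (intro integrable_mult_indicator) (auto intro!: lborelD)

  have f_average: "(\<lambda>k. dyadic_average (g k) n m i j) sums dyadic_average f n m i j" for n m i j
  proof -
    let ?R = "dyadic_rect n m i j"
    have int_R: "integrable lebesgue (\<lambda>z. indicator ?R z *\<^sub>R g k z)" for k
      by (intro integrable_mult_indicator integrable) (auto intro!: lborelD)
    have "(\<lambda>k. LINT z|lebesgue. indicator ?R z *\<^sub>R g k z) sums (LINT z|lebesgue. (\<Sum>k. indicator ?R z *\<^sub>R g k z))"
    proof (rule sums_integral[OF int_R])
      show "AE z in lebesgue. summable (\<lambda>k. norm (indicator ?R z *\<^sub>R g k z))"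
        using summable by eventually_elim (auto simp: nonneg abs_mult intro!: summable_mult)
      show "summable (\<lambda>k. LINT z|lebesgue. norm (indicator ?R z *\<^sub>R g k z))"
      proof (rule summable_comparison_test'[OF summable_integrals, of 0])
        fix k
        have "(LINT z|lebesgue. norm (indicator ?R z *\<^sub>R g k z)) \<le> (LINT z|lebesgue. g k z)"
          using integrable_norm[OF int_R, of k] by (intro integral_mono integrable) (auto simp: indicator_def nonneg)
        then show "norm (LINT z|lebesgue. norm (indicator ?R z *\<^sub>R g k z)) \<le> (LINT z|lebesgue. g k z)"
          by (simp add: abs_of_nonneg integral_nonneg_AE)
      qed
    qed
    moreover have "(LINT z|lebesgue. (\<Sum>k. indicator ?R z *\<^sub>R g k z)) = (LINT z|lebesgue. indicator ?R z *\<^sub>R f z)"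
    proof (rule integral_cong_AE)
      show "AE z in lebesgue. (\<Sum>k. indicator ?R z *\<^sub>R g k z) = indicator ?R z *\<^sub>R f z"
        using summable by eventually_elim (auto simp: f_eq indicator_def)
      show "(\<lambda>z. indicator ?R z *\<^sub>R f z) \<in> borel_measurable lebesgue"
        by (intro borel_measurable_integrable integrable_mult_indicator f_integrable) (auto intro!: lborelD)
      show "(\<lambda>z. \<Sum>k. indicator ?R z *\<^sub>R g k z) \<in> borel_measurable lebesgue"
        by (intro borel_measurable_suminf borel_measurable_integrable int_R)
    qed
    ultimately show ?thesis
      unfolding dyadic_average_def set_lebesgue_integral_def by (simp only: sums_divide)
  qed
  have average_nonneg: "0 \<le> dyadic_average (g k) n m i j" for k n m i j
    unfolding dyadic_average_def set_lebesgue_integral_def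
    by (intro divide_nonneg_nonneg integral_nonneg_AE) (auto simp: nonneg)

  have "oscillation (dyadic_basis C) z f = 0 \<and> oscillation (dyadic_basis D) z f = \<infinity>"
    if z: "z \<in> unit_square" and K0: "\<And>k. k \<ge> K0 \<Longrightarrow> z \<notin> Bad k" "\<And>k. k \<ge> K0 \<Longrightarrow> z \<in> Good k" for z K0
  proof
    have g0: "g k z = 0" if "k \<ge> K0" for k
      using K0(1)[OF that] by (intro vanish) simp
    show "oscillation (dyadic_basis C) z f = 0"
    proof (rule oscillation_eq_0I[OF assms(1) z])
      fix e :: real assume "e > 0"
      then obtain K1 where K1: "(1/2::real) ^ K1 < e / 2"
        using real_arch_pow_inv[of "e / 2" "1 / 2"] by auto
      define K where "K = max K0 K1"
      have K: "K \<ge> K0" "(1/2::real) ^ K * 2 \<le> e"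
      proof -
        have "(1/2::real) ^ K \<le> (1/2) ^ K1" unfolding K_def by (intro power_decreasing) auto
        with K1 show "(1/2::real) ^ K * 2 \<le> e" by linarith
      qed (simp add: K_def)
      have "\<bar>dyadic_average f n m i j - f z\<bar> \<le> e"
        if "n \<in> C" "m \<in> C" "i \<in> {1..2 ^ n}" "j \<in> {1..2 ^ m}" "(\<Sum>k<K. L k) \<le> n" "(\<Sum>k<K. L k) \<le> m"
          "z \<in> dyadic_rect n m i j" for n m i j
      proof -
        have "dyadic_average (g k) n m i j = g k z" if "k < K" for k
        proof (rule dyadic_average_const)
          fix w assume "w \<in> dyadic_rect n m i j"
          moreover have "L k \<le> (\<Sum>k<K. L k)" by (rule member_le_sum) (use that in auto)
          ultimately show "g k w = g k z"
            using \<open>(\<Sum>k<K. L k) \<le> n\<close> \<open>(\<Sum>k<K. L k) \<le> m\<close>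
            by (intro const[OF \<open>i \<in> {1..2 ^ n}\<close> \<open>j \<in> {1..2 ^ m}\<close> _ _ _ \<open>z \<in> dyadic_rect n m i j\<close>]) auto
        qed
        moreover have "f z = (\<Sum>k<K. g k z)"
        proof -
          have "summable (\<lambda>k. g k z)"
            by (rule summable_finite[of "{..<K}"]) (use K(1) in \<open>auto intro!: g0\<close>)
          moreover have "(\<Sum>k. g k z) = (\<Sum>k<K. g k z)"
            by (rule suminf_finite) (use K(1) in \<open>auto intro!: g0\<close>)
          ultimately show ?thesis by (simp add: f_eq)
        qed
        ultimately have fz: "f z = (\<Sum>k<K. dyadic_average (g k) n m i j)" by simp
        have tail: "(\<lambda>k. dyadic_average (g (k + K)) n m i j) sums (dyadic_average f n m i j - f z)"
          unfolding fz using sums_split_initial_segment[OF f_average[of n m i j], of K] .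
        have "(\<lambda>k. (1/2::real) ^ k * (1/2) ^ K) sums (2 * (1/2) ^ K)"
          using sums_mult2[OF geometric_sums[of "1/2::real"], of "(1/2) ^ K"] by simp
        moreover have "dyadic_average (g (k + K)) n m i j \<le> (1/2) ^ k * (1/2) ^ K" for k
          using C_average[OF that(1,2,3,4,7), of "k + K"] K0(1)[of "k + K"] K(1)
          by (simp add: power_add power_divide)
        ultimately have "dyadic_average f n m i j - f z \<le> 2 * (1/2) ^ K"
          using tail by (intro sums_le[OF _ tail]) auto
        moreover have "0 \<le> dyadic_average f n m i j - f z"
          using sums_le[OF _ sums_zero tail] average_nonneg by simp
        ultimately show ?thesis using K(2) by (simp add: mult.commute)
      qed
      then show "\<exists>L. \<forall>n\<in>C. \<forall>m\<in>C. \<forall>i\<in>{1..2 ^ n}. \<forall>j\<in>{1..2 ^ m}.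
        L \<le> n \<longrightarrow> L \<le> m \<longrightarrow> z \<in> dyadic_rect n m i j \<longrightarrow> \<bar>dyadic_average f n m i j - f z\<bar> \<le> e"
        by blast
    qed
    show "oscillation (dyadic_basis D) z f = \<infinity>"
    proof (rule oscillation_eq_infI)
      fix B :: real and L' :: nat
      define k where "k = max (max K0 L') (nat \<lceil>B\<rceil>)"
      have k: "K0 \<le> k" "L' \<le> k" "B \<le> k" unfolding k_def by linarith+
      obtain n m i j where *: "n \<in> D" "m \<in> D" "i \<in> {1..2 ^ n}" "j \<in> {1..2 ^ m}"
        "k \<le> n" "k \<le> m" "z \<in> dyadic_rect n m i j" "k \<le> dyadic_average (g k) n m i j"
        using D_average[OF z K0(2)[OF k(1)]] by blast
      have "dyadic_average (g k) n m i j \<le> dyadic_average f n m i j"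
        using sum_le_suminf[OF sums_summable[OF f_average[of n m i j]], of "{k}"] average_nonneg
        by (simp add: sums_unique[OF f_average[of n m i j]])
      then have "L' \<le> n \<and> L' \<le> m \<and> z \<in> dyadic_rect n m i j \<and> B \<le> dyadic_average f n m i j"
        using * k by linarith
      then show "\<exists>n\<in>D. \<exists>m\<in>D. \<exists>i\<in>{1..2 ^ n}. \<exists>j\<in>{1..2 ^ m}.
        L' \<le> n \<and> L' \<le> m \<and> z \<in> dyadic_rect n m i j \<and> B \<le> dyadic_average f n m i j"
        using *(1,2,3,4) by blast
    qed
  qed
  note pointwise = this
  have "AE z in lebesgue. z \<in> unit_square \<longrightarrow>
      oscillation (dyadic_basis C) z f = 0 \<and> oscillation (dyadic_basis D) z f = \<infinity>"
    using ultimately_good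
  proof eventually_elim
    case (elim z)
    then show ?case using pointwise[of z] by blast
  qed
  moreover have "f z \<ge> 0" for z
    by (simp add: f_def)
  ultimately show ?thesis
    using f_int by blast
qed

section \<open>The characterization\<close>

theorem theorem1p3:
  fixes C D :: "nat set"
  assumes "infinite C" and "infinite D"
  shows "(\<exists>f :: real \<times> real \<Rightarrow> real.
            set_integrable lebesgue unit_square f \<and>
            (\<forall>z\<in>unit_square. f z \<ge> 0) \<and>
            (AE z in lebesgue. z \<in> unit_square \<longrightarrow>
               oscillation (dyadic_basis C) z f = 0 \<and>
               oscillation (dyadic_basis D) z f = \<infinity>))
         \<longleftrightarrow> (SUP n\<in>D. enat (dist_to_set n C)) = \<infinity>"
proof
  assume "(SUP n\<in>D. enat (dist_to_set n C)) = \<infinity>"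
  with \<open>infinite C\<close> show "\<exists>f :: real \<times> real \<Rightarrow> real.
            set_integrable lebesgue unit_square f \<and>
            (\<forall>z\<in>unit_square. f z \<ge> 0) \<and>
            (AE z in lebesgue. z \<in> unit_square \<longrightarrow>
               oscillation (dyadic_basis C) z f = 0 \<and>
               oscillation (dyadic_basis D) z f = \<infinity>)"
    by (rule exists_divergent_function)
next
  assume "\<exists>f :: real \<times> real \<Rightarrow> real.
            set_integrable lebesgue unit_square f \<and>
            (\<forall>z\<in>unit_square. f z \<ge> 0) \<and>
            (AE z in lebesgue. z \<in> unit_square \<longrightarrow>
               oscillation (dyadic_basis C) z f = 0 \<and>
               oscillation (dyadic_basis D) z f = \<infinity>)"
  then obtain f :: "real \<times> real \<Rightarrow> real" where f: "set_integrable lebesgue unit_square f"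
      "\<And>z. z \<in> unit_square \<Longrightarrow> 0 \<le> f z"
    and ae: "AE z in lebesgue. z \<in> unit_square \<longrightarrow>
        oscillation (dyadic_basis C) z f = 0 \<and> oscillation (dyadic_basis D) z f = \<infinity>"
    by blast
  have "AE z in lebesgue. z \<in> unit_square \<longrightarrow> oscillation (dyadic_basis C) z f = 0"
    using ae by eventually_elim blast
  moreover have "AE z in lebesgue. z \<in> unit_square \<longrightarrow> oscillation (dyadic_basis D) z f = \<infinity>"
    using ae by eventually_elim blast
  ultimately show "(SUP n\<in>D. enat (dist_to_set n C)) = \<infinity>"
    using oscillation_finite_somewhere[OF \<open>infinite C\<close> _ f] by blast
qed

end
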